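(* Let $\Bbbk$ be a field, $V$ a finite-dimensional $\Bbbk$-vector space and $R$ a Hecke symmetry on $V$ with parameter $q$. Assume that for some integer $n>0$ one has $\dim\Upsilon^{(n)}=1$ and $\Upsilon^{(n+1)}=0$, and fix $0\neq t\in\Upsilon^{(n)}$. Let $\varphi,\psi,\theta\in GL(V)$ be as defined in the context. Then $\varphi,\psi,\theta$ pairwise commute and $\psi=q^{-n-1}\varphi\,\theta^2$. Moreover, each $\chi\in\{\varphi,\psi,\theta\}$ has the property that $\chi\otimes\chi$ commutes with $R$.
   Context: A Hecke symmetry on $V$ with parameter $0\neq q\in\Bbbk$ is a linear map $R:V\otimes V\to V\otimes V$ satisfying $(R\otimes\mathrm{Id}_V)(\mathrm{Id}_V\otimes R)(R\otimes\mathrm{Id}_V)=(\mathrm{Id}_V\otimes R)(R\otimes\mathrm{Id}_V)(\mathrm{Id}_V\otimes R)$ and $(R-q\,\mathrm{Id})(R+\mathrm{Id})=0$ ($q=-1$ allowed). In the tensor algebra $\mathbb{T}(V)$ the product of homogeneous elements is written by juxtaposition, $ab=a\otimes b$. For $p\ge 2$ and $1\le i\le p-1$ put $R_i^{(p)}=\mathrm{Id}_V^{\otimes(i-1)}\otimes R\otimes\mathrm{Id}_V^{\otimes(p-i-1)}$ acting on $V^{\otimes p}$. Set $\Upsilon^{(0)}=\Bbbk$, $\Upsilon^{(1)}=V$ and $\Upsilon^{(p)}=\bigcap_{i=1}^{p-1}(R_i^{(p)}-q\,\mathrm{Id})V^{\otimes p}$ for $p\ge2$. Hecke algebra: ${\cal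 H}_m$ is generated by $T_1,\dots,T_{m-1}$ with $T_iT_jT_i=T_jT_iT_j$ for $|i-j|=1$, $T_iT_j=T_jT_i$ for $|i-j|>1$, $(T_i-q)(T_i+1)=0$; it has basis $T_\sigma$ ($\sigma$ in the symmetric group $S_m$), $T_\sigma=T_{i_1}\cdots T_{i_r}$ for any reduced expression $\sigma=\tau_{i_1}\cdots\tau_{i_r}$ in the transpositions $\tau_i=(i,i+1)$; $\ell(\sigma)$ is the length. ${\cal H}_m$ acts on $V^{\otimes p}$ ($p\ge m$) with $T_i$ acting as $R_i^{(p)}$. For $0\le k\le m$ let $D_{k,m-k}\subset S_m$ be the set of permutations increasing on $\{1,\dots,k\}$ and on $\{k+1,\dots,m\}$, and $y_{m/k,m-k}=\sum_{d\in D_{k,m-k}}(-1)^{\ell(d)}q^{k(m-k)-\ell(d)}T_d$. The graded vector space $\Upsilon(V,R)=\bigoplus_{k\ge0}\Upsilon^{(k)}$ is a graded associative unital algebra with product $a\star b=y_{k+l/k,l}(ab)$ for $a\in\Upsilon^{(k)}$, $b\in\Upsilon^{(l)}$. The quadratic dual $\mathbb{S}(V,R)^!$ is the quotient of $\mathbb{T}(V^* )$ by the ideal generated by $(\Upsilon^{(2)})^\perp\subset V^*\otimes V^*$ (pairing $\langle f\otimes g,v\otimes w\rangle=f(v)g(w)$). Under the hypotheses, both graded algebras $\Upsilon(V,R)$ and $\mathbb{S}(V,R)^!$ are Frobenius, with top nonzero component in degree $n$. For such a connected graded Frobenius algebra $A=\bigoplus_{k=0}^nA_k$, the (graded) Nakayama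 automorphism is the unique grading-preserving automorphism $\nu$ with $ba=\nu(a)b$ for all $a\in A_k$, $b\in A_{n-k}$, all $k$. Let $\nu$ be the Nakayama automorphism of $(\Upsilon(V,R),\star)$ and $\varphi=\nu|_V$. Let $\psi:V\to V$ be the linear operator whose dual $\psi^*:V^*\to V^*$ is the degree-one component of the Nakayama automorphism of $\mathbb{S}(V,R)^!$. Let $\theta\in GL(V)$ be the operator defined by $R_n^{(n+1)}R_{n-1}^{(n+1)}\cdots R_1^{(n+1)}(vt)=t\,\theta(v)$ for all $v\in V$ (this map sends $Vt$ into $tV$, so $\theta$ is well defined, and it is invertible). *)

theory Defs
  imports Complex_Main "HOL-Library.Function_Algebras"
begin

text \<open>Coordinates.  V is modelled as the coordinate space 'n => 'k over a field 'k, where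
the finite type 'n indexes a basis of V.  An element of V^{tensor p} is a function
'n list => 'k supported on lists of length p (coefficient of e_{x1} ... e_{xp}).
The same representation is used for (V^*)^{tensor p} with respect to the dual basis.
Linear operators on V are matrices 'n => 'n => 'k (columns = images of basis vectors).\<close>

type_synonym ('n, 'k) tensor = "'n list \<Rightarrow> 'k"

definition scl :: "'k::field \<Rightarrow> ('a \<Rightarrow> 'k) \<Rightarrow> ('a \<Rightarrow> 'k)" where
  "scl c f = (\<lambda>x. c * f x)"

lemma vector_space_scl: "vector_space (scl :: 'k::field \<Rightarrow> ('a \<Rightarrow> 'k) \<Rightarrow> _)"
  unfolding vector_space_def scl_def by (auto simp: algebra_simps fun_eq_iff)

definition Tens :: "nat \<Rightarrow> ('n, 'k::field) tensor set" where
  "Tens p = {f. \<forall>xs. f xs \<noteq> 0 \<longrightarrow> length xs = p}"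

definition tmul :: "nat \<Rightarrow> ('n, 'k::field) tensor \<Rightarrow> ('n, 'k) tensor \<Rightarrow> ('n, 'k) tensor" where
  "tmul k a b = (\<lambda>xs. a (take k xs) * b (drop k xs))"

definition tone :: "('n, 'k::field) tensor" where
  "tone = (\<lambda>xs. if xs = [] then 1 else 0)"

definition vec1 :: "('n \<Rightarrow> 'k::field) \<Rightarrow> ('n, 'k) tensor" where
  "vec1 v = (\<lambda>xs. case xs of [x] \<Rightarrow> v x | _ \<Rightarrow> 0)"

definition mv :: "('n::finite \<Rightarrow> 'n \<Rightarrow> 'k::field) \<Rightarrow> ('n \<Rightarrow> 'k) \<Rightarrow> ('n \<Rightarrow> 'k)" where
  "mv M v = (\<lambda>i. \<Sum>j\<in>UNIV. M i j * v j)"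

definition mm :: "('n::finite \<Rightarrow> 'n \<Rightarrow> 'k::field) \<Rightarrow> ('n \<Rightarrow> 'n \<Rightarrow> 'k) \<Rightarrow> ('n \<Rightarrow> 'n \<Rightarrow> 'k)" where
  "mm A B = (\<lambda>i k. \<Sum>j\<in>UNIV. A i j * B j k)"

definition tsq :: "('n::finite \<Rightarrow> 'n \<Rightarrow> 'k::field) \<Rightarrow> ('n, 'k) tensor \<Rightarrow> ('n, 'k) tensor" where
  "tsq M f = (\<lambda>xs. if length xs = 2
      then (\<Sum>a\<in>UNIV. \<Sum>b\<in>UNIV. M (xs!0) a * M (xs!1) b * f [a, b]) else 0)"

text \<open>A linear map R on V tensor V is given by its coefficients:
  R(e_a e_b) = sum over c d of  Rc c d a b * e_c e_d.
  Rop p i R is R_i^{(p)} = Id^{(i-1)} tensor R tensor Id^{(p-i-1)} (1 <= i <= p-1),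
  acting on positions i, i+1 (1-based).\<close>
definition Rop :: "nat \<Rightarrow> nat \<Rightarrow> ('n::finite \<Rightarrow> 'n \<Rightarrow> 'n \<Rightarrow> 'n \<Rightarrow> 'k::field)
    \<Rightarrow> ('n, 'k) tensor \<Rightarrow> ('n, 'k) tensor" where
  "Rop p i R f = (\<lambda>xs. if length xs = p then
      (\<Sum>a\<in>UNIV. \<Sum>b\<in>UNIV. R (xs!(i-1)) (xs!i) a b * f (xs[i-1 := a, i := b])) else 0)"

definition hecke_symmetry :: "('n::finite \<Rightarrow> 'n \<Rightarrow> 'n \<Rightarrow> 'n \<Rightarrow> 'k::field) \<Rightarrow> 'k \<Rightarrow> bool" where
  "hecke_symmetry R q \<longleftrightarrow> q \<noteq> 0 \<and>
     (\<forall>f\<in>Tens 3. Rop 3 1 R (Rop 3 2 R (Rop 3 1 R f)) = Rop 3 2 R (Rop 3 1 R (Rop 3 2 R f))) \<and>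
     (\<forall>f\<in>Tens 2. Rop 2 1 R (Rop 2 1 R f) - scl q (Rop 2 1 R f) + Rop 2 1 R f - scl q f = 0)"

text \<open>Upsilon^{(p)}: for p >= 2 the intersection of the images of R_i^{(p)} - q Id;
  for p = 0, 1 (empty intersection) the whole of V^{tensor p}, i.e. k resp. V.\<close>
definition Ups :: "('n::finite \<Rightarrow> 'n \<Rightarrow> 'n \<Rightarrow> 'n \<Rightarrow> 'k::field) \<Rightarrow> 'k \<Rightarrow> nat \<Rightarrow> ('n, 'k) tensor set" where
  "Ups R q p = {f \<in> Tens p. \<forall>i\<in>{1..<p}. \<exists>g\<in>Tens p. f = Rop p i R g - scl q g}"

definition stau :: "nat \<Rightarrow> nat \<Rightarrow> nat" where
  "stau i = (\<lambda>x. if x = i then i + 1 else if x = i + 1 then i else x)"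

definition word_perm :: "nat list \<Rightarrow> nat \<Rightarrow> nat" where
  "word_perm w = foldr (\<lambda>i f. stau i \<circ> f) w id"

definition reduced_word :: "nat \<Rightarrow> (nat \<Rightarrow> nat) \<Rightarrow> nat list \<Rightarrow> bool" where
  "reduced_word m \<sigma> w \<longleftrightarrow> set w \<subseteq> {1..<m} \<and> word_perm w = \<sigma> \<and>
     (\<forall>w'. set w' \<subseteq> {1..<m} \<and> word_perm w' = \<sigma> \<longrightarrow> length w \<le> length w')"

definition perm_len :: "nat \<Rightarrow> (nat \<Rightarrow> nat) \<Rightarrow> nat" where
  "perm_len m \<sigma> = length (SOME w. reduced_word m \<sigma> w)"

definition Tperm :: "nat \<Rightarrow> ('n::finite \<Rightarrow> 'n \<Rightarrow> 'n \<Rightarrow> 'n \<Rightarrow> 'k::field) \<Rightarrow> (nat \<Rightarrow> nat)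
    \<Rightarrow> ('n, 'k) tensor \<Rightarrow> ('n, 'k) tensor" where
  "Tperm m R \<sigma> f = foldr (\<lambda>i g. Rop m i R g) (SOME w. reduced_word m \<sigma> w) f"

definition shuffles :: "nat \<Rightarrow> nat \<Rightarrow> (nat \<Rightarrow> nat) set" where
  "shuffles k m = {\<sigma>. bij_betw \<sigma> {1..m} {1..m} \<and> (\<forall>x. x \<notin> {1..m} \<longrightarrow> \<sigma> x = x) \<and>
     (\<forall>i j. 1 \<le> i \<and> i < j \<and> j \<le> k \<longrightarrow> \<sigma> i < \<sigma> j) \<and>
     (\<forall>i j. k < i \<and> i < j \<and> j \<le> m \<longrightarrow> \<sigma> i < \<sigma> j)}"

definition star :: "('n::finite \<Rightarrow> 'n \<Rightarrow> 'n \<Rightarrow> 'n \<Rightarrow> 'k::field) \<Rightarrow> 'k \<Rightarrow> nat \<Rightarrow> nat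
    \<Rightarrow> ('n, 'k) tensor \<Rightarrow> ('n, 'k) tensor \<Rightarrow> ('n, 'k) tensor" where
  "star R q k l a b = (\<Sum>d\<in>shuffles k (k + l).
      scl ((-1) ^ perm_len (k + l) d * q ^ (k * l - perm_len (k + l) d))
          (Tperm (k + l) R d (tmul k a b)))"

definition nakayama_Ups :: "('n::finite \<Rightarrow> 'n \<Rightarrow> 'n \<Rightarrow> 'n \<Rightarrow> 'k::field) \<Rightarrow> 'k \<Rightarrow> nat
    \<Rightarrow> (nat \<Rightarrow> ('n, 'k) tensor \<Rightarrow> ('n, 'k) tensor) \<Rightarrow> bool" where
  "nakayama_Ups R q n \<nu> \<longleftrightarrow>
     (\<forall>k. bij_betw (\<nu> k) (Ups R q k) (Ups R q k)) \<and>
     (\<forall>k. \<forall>a\<in>Ups R q k. \<forall>b\<in>Ups R q k. \<forall>c. \<nu> k (a + b) = \<nu> k a + \<nu> k b \<and> \<nu> k (scl c a) = scl c (\<nu> k a)) \<and>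
     (\<forall>k l. \<forall>a\<in>Ups R q k. \<forall>b\<in>Ups R q l. \<nu> (k + l) (star R q k l a b) = star R q k l (\<nu> k a) (\<nu> l b)) \<and>
     \<nu> 0 tone = tone \<and>
     (\<forall>k\<le>n. \<forall>a\<in>Ups R q k. \<forall>b\<in>Ups R q (n - k). star R q (n - k) k b a = star R q k (n - k) (\<nu> k a) b)"

text \<open>Quadratic dual S(V,R)^! = T(V^*)/(Perp), elements of (V^*)^{tensor p} written in the
  dual basis.  Perp = (Upsilon^{(2)})^perp, and Idl p = degree p part of the two-sided ideal.\<close>
definition Perp :: "('n::finite \<Rightarrow> 'n \<Rightarrow> 'n \<Rightarrow> 'n \<Rightarrow> 'k::field) \<Rightarrow> 'k \<Rightarrow> ('n, 'k) tensor set" where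
  "Perp R q = {F \<in> Tens 2. \<forall>f\<in>Ups R q 2. (\<Sum>x\<in>UNIV. \<Sum>y\<in>UNIV. F [x, y] * f [x, y]) = 0}"

definition Idl :: "('n::finite \<Rightarrow> 'n \<Rightarrow> 'n \<Rightarrow> 'n \<Rightarrow> 'k::field) \<Rightarrow> 'k \<Rightarrow> nat \<Rightarrow> ('n, 'k) tensor set" where
  "Idl R q p = Modules.module.span scl
     {tmul (i + 2) (tmul i a r) b | i j a r b. i + 2 + j = p \<and> a \<in> Tens i \<and> r \<in> Perp R q \<and> b \<in> Tens j}"

text \<open>mu is the Nakayama automorphism of S(V,R)^! with top degree n, represented degreewise by
  lifts mu k : (V^*)^{tensor k} -> (V^*)^{tensor k} that preserve the ideal, i.e. a graded
  automorphism of the quotient algebra, all identities holding modulo the ideal.\<close>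
definition nakayama_Sdual :: "('n::finite \<Rightarrow> 'n \<Rightarrow> 'n \<Rightarrow> 'n \<Rightarrow> 'k::field) \<Rightarrow> 'k \<Rightarrow> nat
    \<Rightarrow> (nat \<Rightarrow> ('n, 'k) tensor \<Rightarrow> ('n, 'k) tensor) \<Rightarrow> bool" where
  "nakayama_Sdual R q n \<mu> \<longleftrightarrow>
     (\<forall>k. \<forall>a\<in>Tens k. \<mu> k a \<in> Tens k) \<and>
     (\<forall>k. \<forall>a\<in>Tens k. \<forall>b\<in>Tens k. \<forall>c. \<mu> k (a + b) = \<mu> k a + \<mu> k b \<and> \<mu> k (scl c a) = scl c (\<mu> k a)) \<and>
     (\<forall>k. \<forall>a\<in>Idl R q k. \<mu> k a \<in> Idl R q k) \<and>
     (\<forall>k. \<forall>a\<in>Tens k. \<mu> k a \<in> Idl R q k \<longrightarrow> a \<in> Idl R q k) \<and>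
     (\<forall>k. \<forall>b\<in>Tens k. \<exists>a\<in>Tens k. \<mu> k a - b \<in> Idl R q k) \<and>
     (\<forall>k l. \<forall>a\<in>Tens k. \<forall>b\<in>Tens l. \<mu> (k + l) (tmul k a b) - tmul k (\<mu> k a) (\<mu> l b) \<in> Idl R q (k + l)) \<and>
     \<mu> 0 tone - tone \<in> Idl R q 0 \<and>
     (\<forall>k\<le>n. \<forall>a\<in>Tens k. \<forall>b\<in>Tens (n - k). tmul (n - k) b a - tmul k (\<mu> k a) b \<in> Idl R q n)"

end

theory Submission
  imports Defs
begin

text \<open>Write $A_k = T_k \cdots T_1$.  The alternating sum $v \star t$ lies in $\Upsilon^{(n+1)} = 0$ and its
  last term is $\pm A_n(vt) = \pm t\,\theta(v)$, so contracting its last slot with $e_x^*$ gives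
  $q\,(v \star t_x) = (-1)^{n-1} \theta(v)_x\, t$, where $t_x$ is the contraction of $t$.  On the other side,
  the Jucys-Murphy identity $T_1 \cdots T_n T_n \cdots T_1 (vt) = q^{n+1} vt$ gives
  $q\,({}_xt \star \theta(v)) = (-1)^{n-1} q^{n+1} v_x\, t$.  The Nakayama automorphism of the quadratic dual says
  $t_i = \sum_j \psi_{ij}\, {}_jt$, and comparing the two formulas through $b \star v = \varphi(v) \star b$
  yields $q^{n+1} \psi = \theta \varphi \theta$.

  Contracting two slots in the same way turns the identity
  $(b \star v) \star w = \varphi(w) \star (b \star v) = (\varphi(w) \star b) \star v = \varphi(v) \star (\varphi(w) \star b)$
  into the commutation of $\psi \otimes \psi$ with $R$; this also works for $q = -1$.  Moving two vectors past $t$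
  shows that $\theta \otimes \theta$ commutes with $R$.  Finally $\psi^{\otimes n} t = t$ because $t$ is
  $\psi$-cyclic, so $\psi^{\otimes (n+1)}$ applied to $A_n(vt) = t\,\theta(v)$ gives
  $\psi\theta = \theta\psi$, and the remaining claims follow.  Only products with a vector occur.\<close>

section \<open>Tensors and the operators $R_i$\<close>

text \<open>The case \<open>q = -1\<close> shapes the argument. There the images of
  \<open>R_i - q\<close> that cut out \<Upsilon> may be strictly smaller than the kernels of
  \<open>R_i + 1\<close>, so membership in \<Upsilon> is shown by explicit preimages, and the
  scalars cancelled along the way are signs and powers of \<open>q\<close>. In a product with a
  vector the permutations are cycles with a single reduced word, which makes every product an
  explicit alternating sum of words. Associativity enters in the mixed form (u \<star> x) \<star> v
  = u \<star> (x \<star> v), which interchanges left and right multiplication. The second formula of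
  the overview is the first one for the reversed symmetry: by the Jucys-Murphy identity, if v moves
  past t and becomes \<theta>(v), then after reversal of all words \<theta>(v) moves past the
  reversed t and becomes \<open>q^(n+1)\<close> v. This is the origin of the power of
  \<open>q\<close>, which appears squared when two vectors are moved. The same identity makes
  \<theta> injective.\<close>

definition slice :: "nat \<Rightarrow> 'n list \<Rightarrow> 'n list \<Rightarrow> ('n, 'k::field) tensor \<Rightarrow> ('n, 'k) tensor" where
  "slice r pre post f = (\<lambda>ys. if length ys = r then f (pre @ ys @ post) else 0)"

definition rword :: "nat \<Rightarrow> ('n::finite \<Rightarrow> 'n \<Rightarrow> 'n \<Rightarrow> 'n \<Rightarrow> 'k::field) \<Rightarrow> nat list
    \<Rightarrow> ('n, 'k) tensor \<Rightarrow> ('n, 'k) tensor" where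
  "rword p R w f = foldr (\<lambda>i g. Rop p i R g) w f"

text \<open>The word of the cycle that carries the first tensor factor past the next
  \<open>k\<close> ones: in \<open>rword\<close> the last letter acts first, so
  \<open>rword p R (desc k)\<close> is the operator \<open>A_k\<close> of the overview.\<close>

primrec desc :: "nat \<Rightarrow> nat list" where
  "desc 0 = []"
| "desc (Suc k) = Suc k # desc k"

lemma desc_eq: "desc k = rev [Suc 0..<Suc k]"
  by (induction k) auto

lemma set_desc [simp]: "set (desc k) = {1..k}"
  and length_desc [simp]: "length (desc k) = k"
  by (auto simp: desc_eq)

lemma scl_apply [simp]: "scl c f x = c * f x"
  by (simp add: scl_def)

lemma scl_scl [simp]: "scl a (scl b f) = scl (a * b) f"
  by (simp add: scl_def mult.assoc)

lemma scl_zero_left [simp]: "scl 0 f = 0"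
  and scl_zero_right [simp]: "scl c 0 = 0"
  and scl_one [simp]: "scl 1 f = f"
  by (simp_all add: fun_eq_iff)

lemma scl_add_right: "scl c (f + g) = scl c f + scl c g"
  and scl_diff_right: "scl c (f - g) = scl c f - scl c g"
  by (simp_all add: fun_eq_iff algebra_simps)

lemma sum_fun_apply: "(\<Sum>i\<in>A. f i) x = (\<Sum>i\<in>A. f i x)"
  by (induction A rule: infinite_finite_induct) auto

lemma scl_sum: "scl c (sum f A) = (\<Sum>i\<in>A. scl c (f i))"
  by (simp add: fun_eq_iff sum_fun_apply sum_distrib_left)

lemma scl_cancel:
  assumes "scl a f = scl b f" "f \<noteq> 0"
  shows "a = b"
proof -
  obtain x where "f x \<noteq> 0" using assms(2) by (auto simp: fun_eq_iff)
  moreover have "a * f x = b * f x" using fun_cong[OF assms(1), of x] by simp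
  ultimately show ?thesis by simp
qed

section \<open>Homogeneous tensors, concatenation and words of operators\<close>

lemma Tens_iff: "f \<in> Tens p \<longleftrightarrow> (\<forall>xs. length xs \<noteq> p \<longrightarrow> f xs = 0)"
  by (auto simp: Tens_def)

lemma Tens_zero [simp]: "0 \<in> Tens p"
  and Tens_add: "f \<in> Tens p \<Longrightarrow> g \<in> Tens p \<Longrightarrow> f + g \<in> Tens p"
  and Tens_diff: "f \<in> Tens p \<Longrightarrow> g \<in> Tens p \<Longrightarrow> f - g \<in> Tens p"
  and Tens_scl: "f \<in> Tens p \<Longrightarrow> scl c f \<in> Tens p"
  by (auto simp: Tens_iff)

lemma Tens_sum: "(\<And>i. i \<in> A \<Longrightarrow> f i \<in> Tens p) \<Longrightarrow> sum f A \<in> Tens p"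
  by (auto simp: Tens_iff sum_fun_apply intro: sum.neutral)

lemma Tens_Rop [simp]: "Rop p i R f \<in> Tens p"
  by (auto simp: Tens_iff Rop_def)

lemma Tens_tmul: "a \<in> Tens k \<Longrightarrow> b \<in> Tens l \<Longrightarrow> tmul k a b \<in> Tens (k + l)"
  unfolding Tens_iff tmul_def
  by (metis (no_types, lifting) append_take_drop_id length_append mult_eq_0_iff)

lemma vec1_single [simp]: "vec1 v [x] = v x"
  by (simp add: vec1_def)

lemma Tens_vec1 [simp]: "vec1 v \<in> Tens 1"
  by (auto simp: Tens_iff vec1_def split: list.splits)

lemma Tens_vec1_Suc [simp]: "vec1 v \<in> Tens (Suc 0)"
  using Tens_vec1 by simp

lemma tmul_append: "length xs = k \<Longrightarrow> tmul k a b (xs @ ys) = a xs * b ys"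
  by (simp add: tmul_def)

lemma tmul_vec1_Cons [simp]: "tmul (Suc 0) (vec1 v) b (x # ys) = v x * b ys"
  by (simp add: tmul_def)

lemma tmul_vec1_Nil [simp]: "tmul (Suc 0) (vec1 v) b [] = 0"
  by (simp add: tmul_def vec1_def)

lemma tmul_vec1_snoc: "length ys = k \<Longrightarrow> tmul k a (vec1 v) (ys @ [x]) = a ys * v x"
  by (simp add: tmul_append)

lemma tmul_add_left: "tmul k (a + a') b = tmul k a b + tmul k a' b"
  and tmul_add_right: "tmul k a (b + b') = tmul k a b + tmul k a b'"
  and tmul_diff_right: "tmul k a (b - b') = tmul k a b - tmul k a b'"
  and tmul_scl_left: "tmul k (scl c a) b = scl c (tmul k a b)"
  and tmul_scl_right: "tmul k a (scl c b) = scl c (tmul k a b)"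
  by (auto simp: tmul_def fun_eq_iff algebra_simps)

lemma tmul_sum_left: "tmul k (sum f A) b = (\<Sum>i\<in>A. tmul k (f i) b)"
  and tmul_sum_right: "tmul k a (sum f A) = (\<Sum>i\<in>A. tmul k a (f i))"
  by (auto simp: tmul_def fun_eq_iff sum_fun_apply sum_distrib_left sum_distrib_right)

lemma tmul_assoc: "tmul (k + l) (tmul k a b) c = tmul k a (tmul l b c)"
  by (auto simp: tmul_def fun_eq_iff add.commute mult.assoc take_drop min_def)

lemma Rop_add: "Rop p i R (f + g) = Rop p i R f + Rop p i R g"
  and Rop_diff: "Rop p i R (f - g) = Rop p i R f - Rop p i R g"
  and Rop_scl: "Rop p i R (scl c f) = scl c (Rop p i R f)"
  and Rop_zero [simp]: "Rop p i R 0 = 0"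
  by (auto simp: Rop_def fun_eq_iff algebra_simps sum.distrib sum_subtractf sum_distrib_left)

lemma Rop_sum: "Rop p i R (sum f A) = (\<Sum>j\<in>A. Rop p i R (f j))"
  by (induction A rule: infinite_finite_induct) (simp_all only: not_False_eq_True sum.infinite sum.empty sum.insert Rop_zero Rop_add)

lemma rword_Nil [simp]: "rword p R [] f = f"
  and rword_Cons [simp]: "rword p R (i # w) f = Rop p i R (rword p R w f)"
  and rword_append: "rword p R (u @ w) f = rword p R u (rword p R w f)"
  by (simp_all add: rword_def)

lemma rword_add: "rword p R w (f + g) = rword p R w f + rword p R w g"
  and rword_diff: "rword p R w (f - g) = rword p R w f - rword p R w g"
  and rword_scl: "rword p R w (scl c f) = scl c (rword p R w f)"
  and rword_zero [simp]: "rword p R w 0 = 0"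
  by (induction w) (simp_all add: Rop_add Rop_scl Rop_diff)

lemma rword_sum: "rword p R w (sum f A) = (\<Sum>j\<in>A. rword p R w (f j))"
  by (induction A rule: infinite_finite_induct) (simp_all only: not_False_eq_True sum.infinite sum.empty sum.insert rword_zero rword_add)

lemma Tens_rword [simp]: "f \<in> Tens p \<Longrightarrow> rword p R w f \<in> Tens p"
  by (cases w) auto

lemma Tens_slice [simp]: "slice r pre post f \<in> Tens r"
  by (auto simp: Tens_iff slice_def)

lemma slice_add: "slice r pre post (f + g) = slice r pre post f + slice r pre post g"
  and slice_diff: "slice r pre post (f - g) = slice r pre post f - slice r pre post g"
  and slice_scl: "slice r pre post (scl c f) = scl c (slice r pre post f)"
  by (auto simp: slice_def fun_eq_iff)

text \<open>Freezing the letters outside a window reduces an identity between operators that act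
  inside the window to tensors of degree \<open>r\<close>. This is how relations postulated in
  degrees 2 and 3 reach every degree.\<close>

lemma tens_eqI:
  assumes "f \<in> Tens p" "g \<in> Tens p" "i + r \<le> p"
    and "\<And>pre post. length pre = i \<Longrightarrow> length post = p - i - r \<Longrightarrow>
           slice r pre post f = slice r pre post g"
  shows "f = g"
proof
  fix xs
  show "f xs = g xs"
  proof (cases "length xs = p")
    case True
    let ?pre = "take i xs" and ?ys = "take r (drop i xs)" and ?post = "drop r (drop i xs)"
    have "slice r ?pre ?post f ?ys = slice r ?pre ?post g ?ys"
      using assms(3,4) True by (intro fun_cong[OF assms(4)]) auto
    moreover have "?pre @ ?ys @ ?post = xs" by (metis append_take_drop_id)
    moreover have "length ?ys = r" using assms(3) True by simp
    ultimately show ?thesis by (simp add: slice_def)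
  qed (use assms(1,2) in \<open>auto simp: Tens_iff\<close>)
qed

lemma slice_Rop:
  assumes "1 \<le> i" "i < r" "p = length pre + r + length post" "j = length pre + i"
  shows "slice r pre post (Rop p j R f) = Rop r i R (slice r pre post f)"
proof
  fix ys
  show "slice r pre post (Rop p j R f) ys = Rop r i R (slice r pre post f) ys"
  proof (cases "length ys = r")
    case True
    \<comment> \<open>Writing \<open>i\<close> as a successor removes the truncated
      \<open>i - 1\<close>, so both positions are plain shifts by \<open>length pre\<close>.\<close>
    obtain i' where i: "i = Suc i'" using assms(1) by (cases i) auto
    show ?thesis
      using assms True
      by (simp add: slice_def Rop_def nth_append list_update_append i)
  qed (simp add: slice_def Rop_def)
qed

text \<open>Every window of length \<open>k\<close> at the start of \<open>tmul k c b\<close> is a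
  scalar multiple of \<open>c\<close>, so linearity of the operator settles the claim.\<close>

lemma Rop_tmul_left:
  assumes "a \<in> Tens k" "b \<in> Tens l" "1 \<le> i" "i < k"
  shows "Rop (k + l) i R (tmul k a b) = tmul k (Rop k i R a) b"
proof (rule tens_eqI[where i = 0 and r = k])
  fix pre post :: "'a list"
  assume p: "length pre = 0" "length post = k + l - 0 - k"
  have s: "slice k pre post (tmul k c b) = scl (b post) c" if "c \<in> Tens k" for c
    using that p by (auto simp: slice_def fun_eq_iff tmul_def Tens_iff)
  have "slice k pre post (Rop (k + l) i R (tmul k a b)) = Rop k i R (slice k pre post (tmul k a b))"
    using p assms by (intro slice_Rop) auto
  also have "\<dots> = slice k pre post (tmul k (Rop k i R a) b)"
    by (simp only: s[OF assms(1)] s[OF Tens_Rop] Rop_scl)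
  finally show "slice k pre post (Rop (k + l) i R (tmul k a b)) = slice k pre post (tmul k (Rop k i R a) b)" .
qed (use assms in \<open>auto intro: Tens_tmul\<close>)

lemma Rop_tmul_right:
  assumes "a \<in> Tens k" "b \<in> Tens l" "k < i" "i < k + l"
  shows "Rop (k + l) i R (tmul k a b) = tmul k a (Rop l (i - k) R b)"
proof (rule tens_eqI[where i = k and r = l])
  fix pre post :: "'a list"
  assume p: "length pre = k" "length post = k + l - k - l"
  have s: "slice l pre post (tmul k a c) = scl (a pre) c" if "c \<in> Tens l" for c
    using that p by (auto simp: slice_def fun_eq_iff tmul_def Tens_iff)
  have "slice l pre post (Rop (k + l) i R (tmul k a b)) = Rop l (i - k) R (slice l pre post (tmul k a b))"
    using p assms by (intro slice_Rop) auto
  also have "\<dots> = slice l pre post (tmul k a (Rop l (i - k) R b))"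
    by (simp only: s[OF assms(2)] s[OF Tens_Rop] Rop_scl)
  finally show "slice l pre post (Rop (k + l) i R (tmul k a b)) = slice l pre post (tmul k a (Rop l (i - k) R b))" .
qed (use assms in \<open>auto intro: Tens_tmul\<close>)

lemma rword_tmul_left:
  assumes "a \<in> Tens k" "b \<in> Tens l" "set w \<subseteq> {1..<k}"
  shows "rword (k + l) R w (tmul k a b) = tmul k (rword k R w a) b"
  using assms(3)
proof (induction w)
  case (Cons i w)
  then show ?case using assms(1,2) by (simp add: Rop_tmul_left)
qed simp

lemma rword_tmul_right:
  assumes "a \<in> Tens k" "b \<in> Tens l" "set w \<subseteq> {k<..<k + l}"
  shows "rword (k + l) R w (tmul k a b) = tmul k a (rword l R (map (\<lambda>i. i - k) w) b)"
  using assms(3)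
proof (induction w)
  case (Cons i w)
  then show ?case using assms(1,2) by (simp add: Rop_tmul_right)
qed simp

section \<open>Commutation of operators on disjoint positions\<close>

lemma sum_swap_pairs:
  "(\<Sum>a\<in>A. \<Sum>b\<in>B. \<Sum>c\<in>C. \<Sum>d\<in>D. g a b c d) = (\<Sum>c\<in>C. \<Sum>d\<in>D. \<Sum>a\<in>A. \<Sum>b\<in>B. g a b c d)"
  using sum.swap[of "\<lambda>x y. g (fst x) (snd x) (fst y) (snd y)" "C \<times> D" "A \<times> B"]
  by (simp add: sum.cartesian_product')

lemma Rop_commute_aux:
  assumes "1 \<le> i" "i + 1 < j" "j < p"
  shows "Rop p i R (Rop p j R f) = Rop p j R (Rop p i R f)"
proof
  fix xs
  show "Rop p i R (Rop p j R f) xs = Rop p j R (Rop p i R f) xs"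
  proof (cases "length xs = p")
    case True
    have u: "(xs[i - 1 := a, i := b])[j - 1 := c, j := d] = (xs[j - 1 := c, j := d])[i - 1 := a, i := b]" for a b c d
      using assms by (simp add: list_update_swap)
    have n: "xs[i - 1 := a, i := b] ! (j - 1) = xs ! (j - 1)" "xs[i - 1 := a, i := b] ! j = xs ! j"
      "xs[j - 1 := a, j := b] ! (i - 1) = xs ! (i - 1)" "xs[j - 1 := a, j := b] ! i = xs ! i" for a b
      using assms by auto
    have "Rop p i R (Rop p j R f) xs = (\<Sum>a\<in>UNIV. \<Sum>b\<in>UNIV. \<Sum>c\<in>UNIV. \<Sum>d\<in>UNIV.
        R (xs ! (i - 1)) (xs ! i) a b * (R (xs ! (j - 1)) (xs ! j) c d * f (xs[j - 1 := c, j := d, i - 1 := a, i := b])))"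
      using True by (simp only: Rop_def True simp_thms(6) if_True length_list_update u n sum_distrib_left)
    also have "\<dots> = (\<Sum>c\<in>UNIV. \<Sum>d\<in>UNIV. \<Sum>a\<in>UNIV. \<Sum>b\<in>UNIV.
        R (xs ! (i - 1)) (xs ! i) a b * (R (xs ! (j - 1)) (xs ! j) c d * f (xs[j - 1 := c, j := d, i - 1 := a, i := b])))"
      by (rule sum_swap_pairs)
    also have "\<dots> = Rop p j R (Rop p i R f) xs"
      using True by (simp only: Rop_def True simp_thms(6) if_True length_list_update u n sum_distrib_left mult.left_commute)
    finally show ?thesis .
  qed (simp add: Rop_def)
qed

lemma Rop_commute:
  assumes "i \<in> {1..<p}" "j \<in> {1..<p}" "i + 1 < j \<or> j + 1 < i"
  shows "Rop p i R (Rop p j R f) = Rop p j R (Rop p i R f)"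
  using assms Rop_commute_aux[of i j p R f] Rop_commute_aux[of j i p R f] by auto

lemma Rop_rword_commute:
  assumes "i \<in> {1..<p}" "set w \<subseteq> {1..<p}" "\<And>j. j \<in> set w \<Longrightarrow> i + 1 < j \<or> j + 1 < i"
  shows "Rop p i R (rword p R w f) = rword p R w (Rop p i R f)"
  using assms(2,3)
proof (induction w)
  case (Cons j w)
  then show ?case using assms(1) Rop_commute[of i p j R "rword p R w f"] by simp
qed simp

lemma rword_commute:
  assumes "set u \<subseteq> {1..<p}" "set w \<subseteq> {1..<p}"
    "\<And>i j. i \<in> set u \<Longrightarrow> j \<in> set w \<Longrightarrow> i + 1 < j \<or> j + 1 < i"
  shows "rword p R u (rword p R w f) = rword p R w (rword p R u f)"
  using assms(1,3)
proof (induction u)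
  case (Cons i u)
  then show ?case using assms(2) Rop_rword_commute[of i p w R "rword p R u f"] by simp
qed simp

section \<open>The Hecke relations in every tensor degree\<close>

locale hecke =
  fixes R :: "'n::finite \<Rightarrow> 'n \<Rightarrow> 'n \<Rightarrow> 'n \<Rightarrow> 'k::field" and q :: 'k
  assumes hecke_symmetry: "hecke_symmetry R q"
begin

lemma q_nonzero [simp]: "q \<noteq> 0"
  using hecke_symmetry by (simp add: hecke_symmetry_def)

lemma braid:
  assumes "1 \<le> i" "i + 1 < p"
  shows "Rop p i R (Rop p (i + 1) R (Rop p i R f)) = Rop p (i + 1) R (Rop p i R (Rop p (i + 1) R f))"
proof (rule tens_eqI[where i = "i - 1" and r = 3])
  fix pre post :: "'n list"
  assume p: "length pre = i - 1" "length post = p - (i - 1) - 3"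
  have *: "slice 3 pre post (Rop p i R g) = Rop 3 1 R (slice 3 pre post g)"
    "slice 3 pre post (Rop p (i + 1) R g) = Rop 3 2 R (slice 3 pre post g)" for g
    using assms p by (auto intro: slice_Rop)
  show "slice 3 pre post (Rop p i R (Rop p (i + 1) R (Rop p i R f)))
      = slice 3 pre post (Rop p (i + 1) R (Rop p i R (Rop p (i + 1) R f)))"
    using hecke_symmetry unfolding hecke_symmetry_def * by auto
qed (use assms in auto)

lemma Rop_Rop:
  assumes "i \<in> {1..<p}" "f \<in> Tens p"
  shows "Rop p i R (Rop p i R f) = scl (q - 1) (Rop p i R f) + scl q f"
proof (rule tens_eqI[where i = "i - 1" and r = 2])
  fix pre post :: "'n list"
  assume p: "length pre = i - 1" "length post = p - (i - 1) - 2"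
  have *: "slice 2 pre post (Rop p i R g) = Rop 2 1 R (slice 2 pre post g)" for g
    using assms p by (intro slice_Rop) auto
  let ?g = "slice 2 pre post f"
  have "Rop 2 1 R (Rop 2 1 R ?g) - scl q (Rop 2 1 R ?g) + Rop 2 1 R ?g - scl q ?g = 0"
    using hecke_symmetry unfolding hecke_symmetry_def by simp
  then have "Rop 2 1 R (Rop 2 1 R ?g) = scl (q - 1) (Rop 2 1 R ?g) + scl q ?g"
    by (simp add: fun_eq_iff algebra_simps)
  then show "slice 2 pre post (Rop p i R (Rop p i R f)) = slice 2 pre post (scl (q - 1) (Rop p i R f) + scl q f)"
    by (simp add: * slice_add slice_scl)
qed (insert assms, simp_all add: Tens_add Tens_scl)

text \<open>Conjugation by the cycle \<open>T_k ... T_1\<close> shifts generators by one. The braid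
  relation acts on the two leading letters when they meet \<open>T_i\<close>; every further letter
  on the left commutes with \<open>T_i\<close>.\<close>

lemma Rop_descending:
  assumes "1 \<le> i" "i < k" "k < p"
  shows "Rop p i R (rword p R (desc k) f) = rword p R (desc k) (Rop p (Suc i) R f)"
  using assms(2,3)
proof (induction k)
  case (Suc k)
  show ?case
  proof (cases "i = k")
    case True
    then obtain j where j: "k = Suc j" using assms(1) by (cases k) auto
    have "Rop p (Suc i) R (rword p R (desc j) f) = rword p R (desc j) (Rop p (Suc i) R f)"
      using Suc True j by (intro Rop_rword_commute) auto
    then show ?thesis
      using braid[of i p "rword p R (desc j) f"] Suc True assms(1) by (simp add: j)
  next
    case False
    then have "Rop p i R (rword p R (desc k) f) = rword p R (desc k) (Rop p (Suc i) R f)"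
      using Suc by simp
    moreover have "Rop p i R (Rop p (Suc k) R g) = Rop p (Suc k) R (Rop p i R g)" for g
      using Suc False assms(1) by (intro Rop_commute) auto
    ultimately show ?thesis by simp
  qed
qed simp

lemma rword_descending:
  assumes "set w \<subseteq> {1..<k}" "k < p"
  shows "rword p R w (rword p R (desc k) f)
    = rword p R (desc k) (rword p R (map Suc w) f)"
  using assms(1)
proof (induction w)
  case (Cons i w)
  then show ?case using assms(2) Rop_descending[of i k p "rword p R (map Suc w) f"] by simp
qed simp

end

section \<open>The star product with a vector\<close>

lemma word_perm_Nil [simp]: "word_perm [] x = x"
  and word_perm_Cons [simp]: "word_perm (i # w) x = stau i (word_perm w x)"
  by (simp_all add: word_perm_def)

lemma word_perm_le: "word_perm w x \<le> x + length w"
  by (induction w) (auto simp: stau_def)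

lemma word_perm_ge: "x \<le> word_perm w x + length w"
  by (induction w) (auto simp: stau_def)

text \<open>Equality in \<open>word_perm_le\<close> forces each letter in turn to raise the current
  image of \<open>x\<close> by one, and the only letter that does so is that image itself. The word
  can therefore be read off.\<close>

lemma word_perm_eq_max:
  "word_perm w x = x + length w \<Longrightarrow> w = rev [x..<x + length w]"
proof (induction w)
  case (Cons i w)
  have "word_perm w x \<le> x + length w" by (rule word_perm_le)
  then have "word_perm w x = x + length w \<and> i = x + length w"
    using Cons.prems by (auto simp: stau_def split: if_splits)
  then show ?case using Cons.IH by simp
qed simp

lemma word_perm_eq_min:
  "word_perm w x + length w = x \<Longrightarrow> w = [x - length w..<x]"
proof (induction w)
  case (Cons i w)
  have "x \<le> word_perm w x + length w" by (rule word_perm_ge)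
  then have *: "word_perm w x + length w = x \<and> Suc i = word_perm w x"
    using Cons.prems by (auto simp: stau_def split: if_splits)
  then have "i = x - length (i # w)" "Suc i = x - length w" "i < x" by auto
  moreover have "w = [x - length w..<x]" using Cons.IH * by blast
  ultimately show ?case by (metis upt_conv_Cons)
qed simp

lemma word_perm_descending:
  "word_perm (desc k) x = (if x = 1 then Suc k else if 2 \<le> x \<and> x \<le> Suc k then x - 1 else x)"
  by (induction k) (auto simp: stau_def)

lemma word_perm_ascending:
  assumes "j \<le> m"
  shows "word_perm [j..<m] x = (if x = m then j else if j \<le> x \<and> x < m then Suc x else x)"
  using assms
proof (induction j rule: inc_induct)
  case (step j)
  then show ?case by (auto simp: upt_conv_Cons stau_def)
qed auto

text \<open>The cycles in \<open>shuffles 1\<close> and \<open>shuffles l (Suc l)\<close> have a single reduced word: each letter moves the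
  image of $1$ (resp. $m$) by at most one.  Hence the choice made in \<open>Tperm\<close> is explicit.\<close>

lemma some_reduced_word_descending:
  assumes "k < m"
  shows "Eps (reduced_word m (word_perm (desc k))) = desc k"
proof -
  have lower: "k \<le> length w'" if "word_perm w' = word_perm (desc k)" for w'
    using word_perm_le[of w' 1] that by (simp add: word_perm_descending del: upt_Suc)
  have unique: "w' = desc k" if "word_perm w' = word_perm (desc k)" "length w' \<le> k" for w'
    proof -
    have "word_perm w' 1 = 1 + length w'" "length w' = k"
      using that lower[OF that(1)] by (simp_all add: word_perm_descending)
    then show ?thesis using word_perm_eq_max[of w' 1] by (simp add: desc_eq)
  qed
  have "set (desc k) \<subseteq> {1..<m}" using assms by auto
  then have "reduced_word m (word_perm (desc k)) w \<longleftrightarrow> w = desc k" for w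
    using lower unique unfolding reduced_word_def by (metis length_desc)
  then show ?thesis by (intro some_equality) auto
qed

lemma some_reduced_word_ascending:
  assumes "k < m"
  shows "Eps (reduced_word m (word_perm [m - k..<m])) = [m - k..<m]"
proof -
  have lower: "k \<le> length w'" if "word_perm w' = word_perm [m - k..<m]" for w'
    using word_perm_ge[of m w'] that assms by (simp add: word_perm_ascending)
  have unique: "w' = [m - k..<m]" if "word_perm w' = word_perm [m - k..<m]" "length w' \<le> k" for w'
    using word_perm_eq_min[of w' m] that lower[OF that(1)] assms
    by (simp add: word_perm_ascending)
  have "set [m - k..<m] \<subseteq> {1..<m}" "length [m - k..<m] = k" using assms by auto
  then have "reduced_word m (word_perm [m - k..<m]) w \<longleftrightarrow> w = [m - k..<m]" for w
    using lower unique unfolding reduced_word_def by metis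
  then show ?thesis by (intro some_equality) auto
qed

section \<open>Shuffles with a block of one element\<close>

lemma strict_mono_image_determined:
  fixes f g :: "nat \<Rightarrow> nat"
  assumes "\<And>i j. a \<le> i \<Longrightarrow> i < j \<Longrightarrow> j < b \<Longrightarrow> f i < f j"
    and "\<And>i j. a \<le> i \<Longrightarrow> i < j \<Longrightarrow> j < b \<Longrightarrow> g i < g j"
    and "f ` {a..<b} = g ` {a..<b}" and "x \<in> {a..<b}"
  shows "f x = g x"
proof -
  have sorted: "sorted_wrt (<) (map h [a..<b])"
    if "\<And>i j. a \<le> i \<Longrightarrow> i < j \<Longrightarrow> j < b \<Longrightarrow> h i < h j" for h :: "nat \<Rightarrow> nat"
    using that by (simp add: sorted_wrt_iff_nth_less)
  have "map f [a..<b] = map g [a..<b]"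
    using assms(3) by (intro strict_sorted_equal sorted assms(1,2)) auto
  then show ?thesis using assms(4) by simp
qed

text \<open>Here \<open>c\<close> is the block of size one and \<open>{a..<b}\<close> the other
  block; the last assumption places this interval on one side of \<open>k\<close>. Once the image of
  \<open>c\<close> is known, the rest is the increasing enumeration of the complement.\<close>

lemma shuffles_determined:
  assumes "\<sigma> \<in> shuffles k m" "\<rho> \<in> shuffles k m" "c \<in> {1..m}" "\<sigma> c = \<rho> c"
    and "{1..m} - {c} = {a..<b}" "a > k \<or> b \<le> Suc k"
  shows "\<sigma> = \<rho>"
proof
  fix x
  have bij: "bij_betw \<tau> {1..m} {1..m}" if "\<tau> \<in> shuffles k m" for \<tau>
    using that by (simp add: shuffles_def)
  have image: "\<tau> ` {a..<b} = {1..m} - {\<tau> c}" if "\<tau> \<in> shuffles k m" for \<tau>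
    using bij[OF that] assms(3) unfolding assms(5)[symmetric] bij_betw_def
    by (simp add: inj_on_image_set_diff[where C = "{1..m}"])
  have mono: "\<tau> i < \<tau> j" if "\<tau> \<in> shuffles k m" "a \<le> i" "i < j" "j < b" for \<tau> i j
  proof -
    have "i \<in> {1..m} - {c}" "j \<in> {1..m} - {c}" using that(2-4) unfolding assms(5) by auto
    then show ?thesis using that assms(6) unfolding shuffles_def by auto
  qed
  consider "x = c" | "x \<notin> {1..m}" | "x \<in> {a..<b}" using assms(5) by blast
  then show "\<sigma> x = \<rho> x"
  proof cases
    case 2
    then show ?thesis using assms(1,2) by (simp add: shuffles_def)
  next
    case 3
    show ?thesis
      using image[OF assms(1)] image[OF assms(2)] assms(4) 3
      by (intro strict_mono_image_determined[OF mono[OF assms(1)] mono[OF assms(2)]]) auto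
  qed (use assms(4) in simp)
qed

lemma descending_in_shuffles:
  assumes "k \<le> l"
  shows "word_perm (desc k) \<in> shuffles 1 (Suc l)"
proof -
  have "bij_betw (word_perm (desc k)) {1..Suc l} {1..Suc l}"
    by (rule bij_betw_byWitness[where f' = "\<lambda>y. if y = Suc k then 1 else if y \<le> k then Suc y else y"])
      (use assms in \<open>auto simp: word_perm_descending simp del: upt_Suc\<close>)
  then show ?thesis
    using assms by (auto simp: shuffles_def word_perm_descending simp del: upt_Suc)
qed

lemma ascending_in_shuffles:
  assumes "k \<le> l"
  shows "word_perm [Suc l - k..<Suc l] \<in> shuffles l (Suc l)"
proof -
  have "bij_betw (word_perm [Suc l - k..<Suc l]) {1..Suc l} {1..Suc l}"
    by (rule bij_betw_byWitness[where f' = "\<lambda>y. if y = Suc l - k then Suc l else if Suc l - k \<le> y \<and> y \<le> Suc l then y - 1 else y"])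
      (use assms in \<open>auto simp: word_perm_ascending simp del: upt_Suc\<close>)
  then show ?thesis
    using assms by (auto simp: shuffles_def word_perm_ascending simp del: upt_Suc)
qed

lemma shuffles_1: "shuffles 1 (Suc l) = (\<lambda>k. word_perm (desc k)) ` {..l}"
proof (intro equalityI subsetI)
  fix \<sigma>
  assume s: "\<sigma> \<in> shuffles 1 (Suc l)"
  then have "\<sigma> 1 \<in> {1..Suc l}" unfolding shuffles_def bij_betw_def by auto
  then obtain k where k: "\<sigma> 1 = Suc k" "k \<le> l" by (cases "\<sigma> 1") auto
  have "\<sigma> = word_perm (desc k)"
    using k by (intro shuffles_determined[OF s descending_in_shuffles, where c = 1 and a = 2 and b = "Suc (Suc l)"])
      (auto simp: word_perm_descending simp del: upt_Suc)
  then show "\<sigma> \<in> (\<lambda>k. word_perm (desc k)) ` {..l}" using k by blast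
next
  fix \<sigma> assume "\<sigma> \<in> (\<lambda>k. word_perm (desc k)) ` {..l}"
  then show "\<sigma> \<in> shuffles 1 (Suc l)" using descending_in_shuffles by blast
qed

lemma shuffles_last: "shuffles l (Suc l) = (\<lambda>k. word_perm [Suc l - k..<Suc l]) ` {..l}"
proof (intro equalityI subsetI)
  fix \<sigma>
  assume s: "\<sigma> \<in> shuffles l (Suc l)"
  then have "\<sigma> (Suc l) \<in> {1..Suc l}" unfolding shuffles_def bij_betw_def by auto
  then have k: "Suc l - \<sigma> (Suc l) \<le> l" "Suc l - (Suc l - \<sigma> (Suc l)) = \<sigma> (Suc l)" by auto
  let ?k = "Suc l - \<sigma> (Suc l)"
  have "\<sigma> = word_perm [Suc l - ?k..<Suc l]"
    using k by (intro shuffles_determined[OF s ascending_in_shuffles, where c = "Suc l" and a = 1 and b = "Suc l"])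
      (auto simp: word_perm_ascending simp del: upt_Suc)
  then show "\<sigma> \<in> (\<lambda>k. word_perm [Suc l - k..<Suc l]) ` {..l}" using k(1) by blast
next
  fix \<sigma> assume "\<sigma> \<in> (\<lambda>k. word_perm [Suc l - k..<Suc l]) ` {..l}"
  then show "\<sigma> \<in> shuffles l (Suc l)" using ascending_in_shuffles by blast
qed

text \<open>\<open>lstar\<close> and \<open>rstar\<close> are the products by a vector from the left
  and from the right, as sums over the cycles instead of shuffles; \<open>star_1\<close> and
  \<open>star_last\<close> make the identification. The index \<open>k\<close> is both the length of
  the cycle's word and the number of factors the vector has passed.\<close>

definition lstar :: "('n::finite \<Rightarrow> 'n \<Rightarrow> 'n \<Rightarrow> 'n \<Rightarrow> 'k::field) \<Rightarrow> 'k \<Rightarrow> nat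
    \<Rightarrow> ('n, 'k) tensor \<Rightarrow> ('n, 'k) tensor \<Rightarrow> ('n, 'k) tensor" where
  "lstar R q l v b = (\<Sum>k\<le>l. scl ((-1) ^ k * q ^ (l - k)) (rword (Suc l) R (desc k) (tmul 1 v b)))"

definition rstar :: "('n::finite \<Rightarrow> 'n \<Rightarrow> 'n \<Rightarrow> 'n \<Rightarrow> 'k::field) \<Rightarrow> 'k \<Rightarrow> nat
    \<Rightarrow> ('n, 'k) tensor \<Rightarrow> ('n, 'k) tensor \<Rightarrow> ('n, 'k) tensor" where
  "rstar R q l b v = (\<Sum>k\<le>l. scl ((-1) ^ k * q ^ (l - k)) (rword (Suc l) R [Suc l - k..<Suc l] (tmul l b v)))"

lemma star_1: "star R q 1 l v b = lstar R q l v b"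
proof -
  have inj: "inj_on (\<lambda>k. word_perm (desc k)) {..l}"
    by (rule inj_on_inverseI[where g = "\<lambda>\<sigma>. \<sigma> 1 - 1"]) (simp add: word_perm_descending del: upt_Suc)
  show ?thesis
    unfolding star_def lstar_def plus_1_eq_Suc shuffles_1 sum.reindex[OF inj]
    by (intro sum.cong)
      (simp_all add: perm_len_def Tperm_def rword_def some_reduced_word_descending del: upt_Suc)
qed

lemma star_last: "star R q l 1 b v = rstar R q l b v"
proof -
  have inj: "inj_on (\<lambda>k. word_perm [Suc l - k..<Suc l]) {..l}"
    by (rule inj_on_inverseI[where g = "\<lambda>\<sigma>. Suc l - \<sigma> (Suc l)"]) (simp add: word_perm_ascending del: upt_Suc)
  show ?thesis
    unfolding star_def rstar_def Suc_eq_plus1[symmetric] shuffles_last sum.reindex[OF inj]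
    by (intro sum.cong)
      (simp_all add: perm_len_def Tperm_def rword_def some_reduced_word_ascending del: upt_Suc)
qed

section \<open>Contractions and closure of $\Upsilon$\<close>

definition rcon :: "'n \<Rightarrow> ('n, 'k::field) tensor \<Rightarrow> ('n, 'k) tensor" where
  "rcon x f = (\<lambda>ys. f (ys @ [x]))"

definition lcon :: "'n \<Rightarrow> ('n, 'k::field) tensor \<Rightarrow> ('n, 'k) tensor" where
  "lcon x f = (\<lambda>ys. f (x # ys))"

lemma Tens_rcon [simp]: "f \<in> Tens (Suc p) \<Longrightarrow> rcon x f \<in> Tens p"
  and Tens_lcon [simp]: "f \<in> Tens (Suc p) \<Longrightarrow> lcon x f \<in> Tens p"
  by (auto simp: Tens_iff rcon_def lcon_def)

lemma rcon_add: "rcon x (f + g) = rcon x f + rcon x g"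
  and rcon_diff: "rcon x (f - g) = rcon x f - rcon x g"
  and rcon_scl: "rcon x (scl c f) = scl c (rcon x f)"
  and rcon_zero [simp]: "rcon x 0 = 0"
  by (simp_all add: rcon_def fun_eq_iff)

lemma rcon_sum: "rcon x (sum f A) = (\<Sum>i\<in>A. rcon x (f i))"
  by (simp add: rcon_def fun_eq_iff sum_fun_apply)

lemma rcon_Rop:
  assumes "1 \<le> i" "i < p"
  shows "rcon x (Rop (Suc p) i R f) = Rop p i R (rcon x f)"
  using assms by (auto simp: rcon_def Rop_def fun_eq_iff nth_append list_update_append)

lemma rcon_rword:
  assumes "set w \<subseteq> {1..<p}"
  shows "rcon x (rword (Suc p) R w f) = rword p R w (rcon x f)"
  using assms by (induction w) (simp_all add: rcon_Rop)

lemma rcon_tmul: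
  assumes "a \<in> Tens k" "b \<in> Tens (Suc l)"
  shows "rcon x (tmul k a b) = tmul k a (rcon x b)"
proof
  fix ys
  show "rcon x (tmul k a b) ys = tmul k a (rcon x b) ys"
    using assms by (cases "k \<le> length ys") (auto simp: rcon_def tmul_def Tens_iff)
qed

lemma rcon_tmul_vec1:
  assumes "t \<in> Tens l"
  shows "rcon x (tmul l t (vec1 w)) = scl (w x) t"
proof
  fix ys :: "'a list"
  consider "length ys = l" | "length ys < l" | "l < length ys" by linarith
  then show "rcon x (tmul l t (vec1 w)) ys = scl (w x) t ys"
  proof cases
    case 3
    then obtain y zs where "drop l ys = y # zs" by (cases "drop l ys") auto
    then show ?thesis using assms 3 by (cases zs) (simp_all add: rcon_def tmul_def vec1_def Tens_iff)
  qed (use assms in \<open>auto simp: rcon_def tmul_def vec1_def Tens_iff\<close>)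
qed

lemma sum_closed:
  assumes "0 \<in> S" "\<And>a b. a \<in> S \<Longrightarrow> b \<in> S \<Longrightarrow> a + b \<in> S" "\<And>i. i \<in> A \<Longrightarrow> f i \<in> S"
  shows "sum f A \<in> S"
  using assms(3) by (induction A rule: infinite_finite_induct) (simp_all add: assms(1,2))

context hecke
begin

text \<open>Membership in \<Upsilon> concerns the image of \<open>R_i - q\<close>. For
  \<open>q = -1\<close> it is in general smaller than the eigenspace of \<open>R_i\<close> for -1,
  so preimages have to be tracked.\<close>

definition image_Rq :: "nat \<Rightarrow> nat \<Rightarrow> ('n, 'k) tensor set" where
  "image_Rq p i = {Rop p i R g - scl q g | g. g \<in> Tens p}"

lemma image_RqI: "g \<in> Tens p \<Longrightarrow> Rop p i R g - scl q g \<in> image_Rq p i"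
  by (auto simp: image_Rq_def)

lemma image_Rq_zero: "0 \<in> image_Rq p i"
  using image_RqI[OF Tens_zero] by simp

lemma image_Rq_add:
  assumes "f \<in> image_Rq p i" "g \<in> image_Rq p i"
  shows "f + g \<in> image_Rq p i"
proof -
  obtain f' g' where *: "f = Rop p i R f' - scl q f'" "g = Rop p i R g' - scl q g'"
    and "f' \<in> Tens p" "g' \<in> Tens p"
    using assms unfolding image_Rq_def by blast
  moreover have "f + g = Rop p i R (f' + g') - scl q (f' + g')"
    unfolding * by (simp add: Rop_add scl_add_right)
  ultimately show ?thesis
    by (simp only: image_RqI Tens_add)
qed

lemma image_Rq_scl:
  assumes "f \<in> image_Rq p i"
  shows "scl c f \<in> image_Rq p i"
proof -
  obtain f' where "f = Rop p i R f' - scl q f'" "f' \<in> Tens p"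
    using assms unfolding image_Rq_def by blast
  then show ?thesis
    using image_RqI[OF Tens_scl, of f' p i c] by (simp add: Rop_scl scl_diff_right mult.commute)
qed

lemma image_Rq_sum: "(\<And>j. j \<in> A \<Longrightarrow> f j \<in> image_Rq p i) \<Longrightarrow> sum f A \<in> image_Rq p i"
  by (rule sum_closed) (simp_all only: image_Rq_zero image_Rq_add)

lemma Ups_iff: "f \<in> Ups R q p \<longleftrightarrow> f \<in> Tens p \<and> (\<forall>i\<in>{1..<p}. f \<in> image_Rq p i)"
  by (auto simp: Ups_def image_Rq_def)

lemma Ups_Tens: "f \<in> Ups R q p \<Longrightarrow> f \<in> Tens p"
  by (simp add: Ups_iff)

lemma Ups_1: "Ups R q (Suc 0) = Tens (Suc 0)"
  by (auto simp: Ups_iff)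

lemma Rop_Ups:
  assumes "f \<in> Ups R q p" "i \<in> {1..<p}"
  shows "Rop p i R f = scl (-1) f"
proof -
  obtain g where "f = Rop p i R g - scl q g" "g \<in> Tens p"
    using assms unfolding Ups_iff image_Rq_def by blast
  then show ?thesis
    using Rop_Rop[OF assms(2), of g]
    by (simp add: Rop_diff Rop_scl scl_diff_right) (simp add: fun_eq_iff algebra_simps)
qed

lemma rword_Ups:
  assumes "f \<in> Ups R q p" "set w \<subseteq> {1..<p}"
  shows "rword p R w f = scl ((-1) ^ length w) f"
  using assms(2) by (induction w) (simp_all add: Rop_scl Rop_Ups[OF assms(1)])

text \<open>A window sees the operators inside it only, so a preimage under \<open>R_j - q\<close>
  restricts to a preimage in the window.\<close>

lemma slice_Ups:
  assumes "f \<in> Ups R q p" "length pre + r + length post = p"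
  shows "slice r pre post f \<in> Ups R q r"
  unfolding Ups_iff
proof (intro conjI ballI)
  fix i assume i: "i \<in> {1..<r}"
  have "length pre + i \<in> {1..<p}" using i assms(2) by auto
  then obtain g where "f = Rop p (length pre + i) R g - scl q g" "g \<in> Tens p"
    using assms(1) unfolding Ups_iff image_Rq_def by blast
  then have "slice r pre post f = Rop r i R (slice r pre post g) - scl q (slice r pre post g)"
    using i assms(2) slice_Rop[of i r p pre post "length pre + i" R g] by (simp add: slice_diff slice_scl)
  then show "slice r pre post f \<in> image_Rq r i" by (simp add: image_RqI)
qed simp

lemma rcon_Ups:
  assumes "f \<in> Ups R q (Suc p)"
  shows "rcon x f \<in> Ups R q p"
proof -
  have "rcon x f = slice p [] [x] f"
    using Ups_Tens[OF assms] by (auto simp: rcon_def slice_def Tens_iff fun_eq_iff)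
  then show ?thesis using slice_Ups[OF assms, of "[]" p "[x]"] by simp
qed

lemma lcon_Ups:
  assumes "f \<in> Ups R q (Suc p)"
  shows "lcon x f \<in> Ups R q p"
proof -
  have "lcon x f = slice p [x] [] f"
    using Ups_Tens[OF assms] by (auto simp: lcon_def slice_def Tens_iff fun_eq_iff)
  then show ?thesis using slice_Ups[OF assms, of "[x]" p "[]"] by simp
qed

lemma tmul_image_Rq:
  assumes "v \<in> Tens 1" "b \<in> image_Rq l i" "1 \<le> i" "i < l"
  shows "\<exists>g\<in>Tens (Suc l). tmul 1 v b = Rop (Suc l) (Suc i) R g - scl q g"
proof -
  obtain b' where "b = Rop l i R b' - scl q b'" "b' \<in> Tens l"
    using assms unfolding image_Rq_def by blast
  then have "tmul 1 v b = Rop (Suc l) (Suc i) R (tmul 1 v b') - scl q (tmul 1 v b')"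
    using Rop_tmul_right[OF assms(1), of b' l "Suc i" R] assms(3,4)
    by (simp add: tmul_diff_right tmul_scl_right)
  then show ?thesis using Tens_tmul[OF assms(1) \<open>b' \<in> Tens l\<close>] by auto
qed

text \<open>For each \<open>R_i\<close> separately, all terms except those with k = i - 1 and k = i
  inherit a preimage from \<open>b\<close>. The two exceptional terms have words that differ by the
  letter \<open>i\<close> and coefficients in the ratio -q, so together they are a multiple of
  \<open>R_i - q\<close> applied to the shorter one.\<close>

lemma lstar_Ups:
  assumes v: "v \<in> Tens 1" and b: "b \<in> Ups R q l"
  shows "lstar R q l v b \<in> Ups R q (Suc l)"
  unfolding Ups_iff
proof (intro conjI ballI)
  have vb: "tmul 1 v b \<in> Tens (Suc l)" using Tens_tmul[OF v Ups_Tens[OF b]] by simp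
  show "lstar R q l v b \<in> Tens (Suc l)"
    unfolding lstar_def using vb by (intro Tens_sum Tens_scl Tens_rword)
  fix i assume i: "i \<in> {1..<Suc l}"
  then obtain j where j: "i = Suc j" by (cases i) auto
  let ?c = "\<lambda>k. (-1) ^ k * q ^ (l - k)"
  let ?g = "\<lambda>k. rword (Suc l) R (desc k) (tmul 1 v b)"
  \<comment> \<open>If k < i - 1, the letter \<open>i\<close> commutes with the word and meets
    \<open>b\<close> as its letter i - 1. If k > i, it passes the word as i + 1 and meets
    \<open>b\<close> as its letter \<open>i\<close>. The preimage for \<open>b\<close> is
    transported accordingly.\<close>
  have im: "?g k \<in> image_Rq (Suc l) i" if "k \<le> l" "k \<noteq> i" "k \<noteq> j" for k
  proof (cases "k < j")
    case True
    then have "b \<in> image_Rq l j" using b i j unfolding Ups_iff by auto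
    then obtain g where g: "g \<in> Tens (Suc l)" "tmul 1 v b = Rop (Suc l) i R g - scl q g"
      using tmul_image_Rq[OF v, of b l j] True i j by auto
    have "Rop (Suc l) i R (rword (Suc l) R (desc k) g) = rword (Suc l) R (desc k) (Rop (Suc l) i R g)"
      using True i j that by (intro Rop_rword_commute) auto
    then have "?g k = Rop (Suc l) i R (rword (Suc l) R (desc k) g) - scl q (rword (Suc l) R (desc k) g)"
      by (simp only: g rword_diff rword_scl)
    then show ?thesis using g(1) by (simp add: image_RqI)
  next
    case False
    then have k: "i < k" "k \<le> l" using that j by auto
    then have "b \<in> image_Rq l i" using b i unfolding Ups_iff by auto
    then obtain g where g: "g \<in> Tens (Suc l)" "tmul 1 v b = Rop (Suc l) (Suc i) R g - scl q g"
      using tmul_image_Rq[OF v, of b l i] i k by auto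
    have "Rop (Suc l) i R (rword (Suc l) R (desc k) g) = rword (Suc l) R (desc k) (Rop (Suc l) (Suc i) R g)"
      using i k by (intro Rop_descending) auto
    then have "?g k = Rop (Suc l) i R (rword (Suc l) R (desc k) g) - scl q (rword (Suc l) R (desc k) g)"
      by (simp only: g rword_diff rword_scl)
    then show ?thesis using g(1) by (simp add: image_RqI)
  qed
  have "q ^ (l - j) = q * q ^ (l - i)"
    using i by (simp add: j Suc_diff_Suc flip: power_Suc)
  \<comment> \<open>This ratio is where the signs and powers of \<open>q\<close> in the definition
    of the product matter.\<close>
  then have c: "?c j = - (q * ?c i)" by (simp add: j)
  have "scl (?c j) (?g j) + scl (?c i) (?g i)
      = Rop (Suc l) i R (scl (?c i) (?g j)) - scl q (scl (?c i) (?g j))"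
    using c by (simp add: j Rop_scl fun_eq_iff del: power_Suc)
  then have pair: "scl (?c j) (?g j) + scl (?c i) (?g i) \<in> image_Rq (Suc l) i"
    using image_RqI[OF Tens_scl[OF Tens_rword[OF vb]]] by simp
  have "lstar R q l v b = (\<Sum>k\<in>{..l} - {i, j}. scl (?c k) (?g k)) + (\<Sum>k\<in>{i, j}. scl (?c k) (?g k))"
    unfolding lstar_def using i j by (intro sum.subset_diff) auto
  also have "(\<Sum>k\<in>{i, j}. scl (?c k) (?g k)) = scl (?c j) (?g j) + scl (?c i) (?g i)"
    by (simp add: j add.commute)
  finally have eq: "lstar R q l v b = (\<Sum>k\<in>{..l} - {i, j}. scl (?c k) (?g k)) + (scl (?c j) (?g j) + scl (?c i) (?g i))" .
  have "(\<Sum>k\<in>{..l} - {i, j}. scl (?c k) (?g k)) \<in> image_Rq (Suc l) i"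
    by (intro image_Rq_sum image_Rq_scl im) auto
  then show "lstar R q l v b \<in> image_Rq (Suc l) i"
    unfolding eq using pair by (rule image_Rq_add)
qed

end

section \<open>Mirror symmetry\<close>

text \<open>Reversing all words turns products with a vector on the right into products on the left.\<close>

definition mirror :: "('n, 'k::field) tensor \<Rightarrow> ('n, 'k) tensor" where
  "mirror f = (\<lambda>xs. f (rev xs))"

text \<open>The conjugate of \<open>R\<close> by the flip of the two tensor factors, which is what
  \<open>R\<close> becomes on reversed words.\<close>

definition opp :: "('n \<Rightarrow> 'n \<Rightarrow> 'n \<Rightarrow> 'n \<Rightarrow> 'k) \<Rightarrow> 'n \<Rightarrow> 'n \<Rightarrow> 'n \<Rightarrow> 'n \<Rightarrow> 'k" where
  "opp R = (\<lambda>x y a b. R y x b a)"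

lemma mirror_mirror [simp]: "mirror (mirror f) = f"
  by (simp add: mirror_def)

lemma opp_opp [simp]: "opp (opp R) = R"
  by (simp add: opp_def)

lemma mirror_Tens [simp]: "mirror f \<in> Tens p \<longleftrightarrow> f \<in> Tens p"
  unfolding Tens_iff mirror_def by (metis length_rev rev_rev_ident)

lemma mirror_add: "mirror (f + g) = mirror f + mirror g"
  and mirror_diff: "mirror (f - g) = mirror f - mirror g"
  and mirror_scl: "mirror (scl c f) = scl c (mirror f)"
  and mirror_zero [simp]: "mirror 0 = 0"
  by (simp_all add: mirror_def fun_eq_iff)

lemma mirror_sum: "mirror (sum f A) = (\<Sum>i\<in>A. mirror (f i))"
  by (simp add: mirror_def fun_eq_iff sum_fun_apply)

lemma mirror_eq_iff: "mirror f = mirror g \<longleftrightarrow> f = g"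
  by (metis mirror_mirror)

lemma mirror_vec1 [simp]: "mirror (vec1 v) = vec1 v"
proof
  fix xs show "mirror (vec1 v) xs = vec1 v xs"
  proof (cases "length xs = 1")
    case True
    then obtain x where "xs = [x]" by (auto simp: length_Suc_conv)
    then show ?thesis by (simp add: mirror_def)
  next
    case False
    then show ?thesis using Tens_vec1[of v] by (simp add: Tens_iff mirror_def)
  qed
qed

lemma mirror_lcon: "mirror (lcon x f) = rcon x (mirror f)"
  by (simp add: mirror_def rcon_def lcon_def)

lemma mirror_tmul:
  assumes "a \<in> Tens k" "b \<in> Tens l"
  shows "mirror (tmul k a b) = tmul l (mirror b) (mirror a)"
proof
  fix xs
  show "mirror (tmul k a b) xs = tmul l (mirror b) (mirror a) xs"
  proof (cases "length xs = k + l")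
    case True
    then show ?thesis by (simp add: mirror_def tmul_def take_rev drop_rev mult.commute)
  next
    case False
    have "mirror (tmul k a b) \<in> Tens (k + l)" "tmul l (mirror b) (mirror a) \<in> Tens (l + k)"
      using assms by (simp_all add: Tens_tmul)
    then show ?thesis using False by (simp add: Tens_iff add.commute)
  qed
qed

text \<open>Reversal sends the pair of positions i, i + 1 to p - i, p - i + 1 in the opposite order;
  the exchanged order is absorbed by \<open>opp\<close> and by swapping the two sums.\<close>

lemma mirror_Rop:
  assumes "1 \<le> i" "i < p"
  shows "mirror (Rop p i R f) = Rop p (p - i) (opp R) (mirror f)"
proof
  fix xs
  show "mirror (Rop p i R f) xs = Rop p (p - i) (opp R) (mirror f) xs"
  proof (cases "length xs = p")
    case True
    have n: "rev xs ! (i - 1) = xs ! (p - i)" "rev xs ! i = xs ! (p - i - 1)"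
      using True assms by (simp_all add: rev_nth)
    have u: "rev (xs[p - i - 1 := b, p - i := a]) = (rev xs)[i - 1 := a, i := b]" for a b
    proof -
      have "rev (xs[p - i - 1 := b, p - i := a]) = (rev xs)[i := b, i - 1 := a]"
        using True assms by (simp add: rev_update)
      also have "\<dots> = (rev xs)[i - 1 := a, i := b]"
        using assms by (intro list_update_swap) auto
      finally show ?thesis .
    qed
    have "mirror (Rop p i R f) xs
        = (\<Sum>a\<in>UNIV. \<Sum>b\<in>UNIV. R (xs ! (p - i)) (xs ! (p - i - 1)) a b * f ((rev xs)[i - 1 := a, i := b]))"
      using True by (simp only: mirror_def Rop_def length_rev n True simp_thms(6) if_True)
    also have "\<dots> = (\<Sum>b\<in>UNIV. \<Sum>a\<in>UNIV. R (xs ! (p - i)) (xs ! (p - i - 1)) a b * f ((rev xs)[i - 1 := a, i := b]))"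
      by (rule sum.swap)
    also have "\<dots> = Rop p (p - i) (opp R) (mirror f) xs"
      using True by (simp only: mirror_def Rop_def opp_def u True simp_thms(6) if_True)
    finally show ?thesis .
  qed (simp add: mirror_def Rop_def)
qed

lemma mirror_rword:
  assumes "set w \<subseteq> {1..<p}"
  shows "mirror (rword p R w f) = rword p (opp R) (map (\<lambda>i. p - i) w) (mirror f)"
  using assms by (induction w) (simp_all add: mirror_Rop)

lemma map_reflect_ascending: "k \<le> l \<Longrightarrow> map (\<lambda>i. Suc l - i) [Suc l - k..<Suc l] = desc k"
proof (induction k)
  case (Suc k)
  then have "[Suc l - Suc k..<Suc l] = (l - k) # [Suc l - k..<Suc l]"
    using upt_conv_Cons[of "l - k" "Suc l"] by (simp add: Suc_diff_le del: upt_Suc)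
  then show ?case using Suc by (simp del: upt_Suc)
qed simp

lemma mirror_rstar:
  assumes "b \<in> Tens l" "v \<in> Tens 1"
  shows "mirror (rstar R q l b v) = lstar (opp R) q l (mirror v) (mirror b)"
  unfolding rstar_def lstar_def mirror_sum mirror_scl
  using assms
  by (intro sum.cong refl, subst mirror_rword)
    (auto simp: map_reflect_ascending mirror_tmul[OF assms] simp del: upt_Suc)

lemma mirror_Ups_aux:
  assumes "f \<in> Ups R q p"
  shows "mirror f \<in> Ups (opp R) q p"
  unfolding Ups_def
proof (intro CollectI conjI ballI)
  show "mirror f \<in> Tens p" using assms by (simp add: Ups_def)
  fix i assume i: "i \<in> {1..<p}"
  then have pi: "p - i \<in> {1..<p}" by auto
  then obtain g where g: "g \<in> Tens p" "f = Rop p (p - i) R g - scl q g"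
    using assms unfolding Ups_def by blast
  have "mirror f = Rop p i (opp R) (mirror g) - scl q (mirror g)"
    using i pi mirror_Rop[of "p - i" p R g] by (simp add: g mirror_diff mirror_scl)
  then show "\<exists>g\<in>Tens p. mirror f = Rop p i (opp R) g - scl q g"
    using g(1) by (metis mirror_Tens)
qed

lemma mirror_Ups: "mirror f \<in> Ups (opp R) q p \<longleftrightarrow> f \<in> Ups R q p"
  using mirror_Ups_aux[of f R q p] mirror_Ups_aux[of "mirror f" "opp R" q p] by auto

text \<open>In degree 3 reversal exchanges the two operators, and the braid relation is symmetric in
  them.\<close>

lemma hecke_symmetry_opp:
  assumes "hecke_symmetry R q"
  shows "hecke_symmetry (opp R) q"
  unfolding hecke_symmetry_def
proof (intro conjI ballI)
  show "q \<noteq> 0" using assms by (simp add: hecke_symmetry_def)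
next
  fix f :: "('a, 'b) tensor" assume "f \<in> Tens 3"
  then have "mirror f \<in> Tens 3" by simp
  then have "Rop 3 1 R (Rop 3 2 R (Rop 3 1 R (mirror f))) = Rop 3 2 R (Rop 3 1 R (Rop 3 2 R (mirror f)))"
    using assms unfolding hecke_symmetry_def by blast
  from arg_cong[OF this, of mirror]
  show "Rop 3 1 (opp R) (Rop 3 2 (opp R) (Rop 3 1 (opp R) f)) = Rop 3 2 (opp R) (Rop 3 1 (opp R) (Rop 3 2 (opp R) f))"
    by (simp add: mirror_Rop eval_nat_numeral)
next
  fix f :: "('a, 'b) tensor" assume "f \<in> Tens 2"
  then have "mirror f \<in> Tens 2" by simp
  then have "Rop 2 1 R (Rop 2 1 R (mirror f)) - scl q (Rop 2 1 R (mirror f)) + Rop 2 1 R (mirror f) - scl q (mirror f) = 0"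
    using assms unfolding hecke_symmetry_def by blast
  from arg_cong[OF this, of mirror]
  show "Rop 2 1 (opp R) (Rop 2 1 (opp R) f) - scl q (Rop 2 1 (opp R) f) + Rop 2 1 (opp R) f - scl q f = 0"
    by (simp add: mirror_Rop mirror_add mirror_diff mirror_scl)
qed

lemma (in hecke) rstar_Ups:
  assumes "b \<in> Ups R q l" "v \<in> Tens 1"
  shows "rstar R q l b v \<in> Ups R q (Suc l)"
proof -
  interpret o: hecke "opp R" q by standard (rule hecke_symmetry_opp[OF hecke_symmetry])
  have "lstar (opp R) q l (mirror v) (mirror b) \<in> Ups (opp R) q (Suc l)"
    using assms by (intro o.lstar_Ups) (simp_all add: mirror_Ups)
  then show ?thesis
    using mirror_rstar[OF Ups_Tens[OF assms(1)] assms(2), of R q] mirror_Ups[of "rstar R q l b v" R q] by simp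
qed

section \<open>Associativity with vectors on both sides\<close>

lemma lstar_add_right: "lstar R q l v (b + c) = lstar R q l v b + lstar R q l v c"
  and lstar_diff_right: "lstar R q l v (b - c) = lstar R q l v b - lstar R q l v c"
  by (simp_all only: lstar_def tmul_add_right tmul_diff_right rword_add rword_diff scl_add_right
      scl_diff_right sum.distrib sum_subtractf)

lemma lstar_scl_right: "lstar R q l v (scl c b) = scl c (lstar R q l v b)"
  by (simp only: lstar_def tmul_scl_right rword_scl scl_sum scl_scl mult.commute)

lemma lstar_zero_right [simp]: "lstar R q l v 0 = 0"
  using lstar_scl_right[of R q l v 0 0] by simp

lemma lstar_sum_right: "lstar R q l v (sum f A) = (\<Sum>i\<in>A. lstar R q l v (f i))"
  using sum_comp_morphism[of "lstar R q l v" f A] by (simp add: lstar_add_right o_def)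

lemma rstar_add_left: "rstar R q l (b + c) v = rstar R q l b v + rstar R q l c v"
  by (simp only: rstar_def tmul_add_left rword_add scl_add_right sum.distrib)

lemma rstar_scl_left: "rstar R q l (scl c b) v = scl c (rstar R q l b v)"
  by (simp only: rstar_def tmul_scl_left rword_scl scl_sum scl_scl mult.commute)

lemma rstar_zero_left [simp]: "rstar R q l 0 v = 0"
  using rstar_scl_left[of R q l 0 0 v] by simp

lemma rstar_sum_left: "rstar R q l (sum f A) v = (\<Sum>i\<in>A. rstar R q l (f i) v)"
  using sum_comp_morphism[of "\<lambda>b. rstar R q l b v" f A] by (simp add: rstar_add_left o_def)

context hecke
begin

text \<open>The letters of the two words are 1, ..., a and m - b, ..., m - 1. They are far apart
  when \<open>a + b \<le> l\<close>; otherwise the left vector crosses the right one, and one letter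
  is traded between the words. The total length \<open>a + b\<close> is preserved, and it is all
  that the coefficients depend on.\<close>

lemma descending_ascending_commute:
  assumes "a \<le> Suc l" "b \<le> l" and m: "m = Suc (Suc l)"
  shows "rword m R (desc a) (rword m R [m - b..<m] X)
    = (if a + b \<le> l then rword m R [m - b..<m] (rword m R (desc a) X)
       else rword m R [m - Suc b..<m] (rword m R (desc (a - 1)) X))"
proof (cases "a + b \<le> l")
  case True
  then have "rword m R (desc a) (rword m R [m - b..<m] X) = rword m R [m - b..<m] (rword m R (desc a) X)"
    using m by (intro rword_commute) auto
  then show ?thesis using True by simp
next
  case False
  then obtain c where c: "a = Suc c" using assms(2) by (cases a) auto
  let ?w = "[m - Suc b..<Suc c]"
  have s: "m - b = Suc (m - Suc b)" using assms(2) m by simp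
  have "m - b \<le> Suc (Suc c)" "Suc (Suc c) + (m - Suc (Suc c)) = m" using assms(1) False m c by auto
  \<comment> \<open>The cut is made at \<open>a = Suc c\<close>: letters up to it pass to the left
    through \<open>desc a\<close>, shifted down by one, while the later ones commute with
    \<open>desc c\<close>.\<close>
  then have "[m - b..<m] = [m - b..<Suc (Suc c)] @ [Suc (Suc c)..<m]"
    using upt_add_eq_append[of "m - b" "Suc (Suc c)" "m - Suc (Suc c)"] by (simp only:)
  also have "[m - b..<Suc (Suc c)] = map Suc ?w"
    by (simp only: s map_Suc_upt)
  finally have "rword m R (desc a) (rword m R [m - b..<m] X)
      = rword m R (desc (Suc c)) (rword m R (map Suc ?w) (rword m R [Suc (Suc c)..<m] X))"
    by (simp only: c rword_append)
  also have "\<dots> = rword m R ?w (rword m R (desc (Suc c)) (rword m R [Suc (Suc c)..<m] X))"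
    using assms c by (intro rword_descending[symmetric]) auto
  also have "rword m R (desc (Suc c)) (rword m R [Suc (Suc c)..<m] X)
      = Rop m (Suc c) R (rword m R [Suc (Suc c)..<m] (rword m R (desc c) X))"
  proof -
    have "rword m R (desc c) (rword m R [Suc (Suc c)..<m] X) = rword m R [Suc (Suc c)..<m] (rword m R (desc c) X)"
      using assms(1) c m by (intro rword_commute) auto
    then show ?thesis by simp
  qed
  also have "rword m R ?w (Rop m (Suc c) R (rword m R [Suc (Suc c)..<m] (rword m R (desc c) X)))
      = rword m R (?w @ Suc c # [Suc (Suc c)..<m]) (rword m R (desc c) X)"
    by (simp only: rword_append rword_Cons)
  also have "?w @ Suc c # [Suc (Suc c)..<m] = [m - Suc b..<m]"
  proof -
    have "Suc c # [Suc (Suc c)..<m] = [Suc c..<m]"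
      using assms(1) c m by (intro upt_conv_Cons[symmetric]) auto
    then show ?thesis
      using False c m assms(1) upt_add_eq_append[of "m - Suc b" "Suc c" "m - Suc c"] by simp
  qed
  finally show ?thesis using False c by simp
qed

text \<open>Both sides are double sums over pairs of words applied to the same tensor, with
  coefficients depending on the total length only. It remains to match the pairs, where one range
  has \<open>a\<close> up to l + 1 and the other has \<open>b\<close> up to l + 1.\<close>

lemma lstar_rstar_assoc:
  assumes u: "u \<in> Tens 1" and x: "x \<in> Tens l" and v: "v \<in> Tens 1"
  shows "rstar R q (Suc l) (lstar R q l u x) v = lstar R q (Suc l) u (rstar R q l x v)"
proof -
  define m where m: "m = Suc (Suc l)"
  define X where "X = tmul 1 u (tmul l x v)"
  have X: "X = tmul (Suc l) (tmul 1 u x) v"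
    using tmul_assoc[of 1 l u x v] by (simp add: X_def)
  have ux: "tmul 1 u x \<in> Tens (Suc l)" and xv: "tmul l x v \<in> Tens (Suc l)"
    using Tens_tmul[OF u x] Tens_tmul[OF x v] by simp_all
  let ?c = "\<lambda>a b. (-1) ^ (a + b) * q ^ (2 * l + 1 - (a + b))"
  let ?F = "\<lambda>a b. scl (?c a b) (rword m R (desc a) (rword m R [m - b..<m] X))"
  let ?G = "\<lambda>b a. scl (?c a b) (rword m R [m - b..<m] (rword m R (desc a) X))"
  have coef: "(-1) ^ i * q ^ (Suc l - i) * ((-1) ^ j * q ^ (l - j)) = ?c j i" if "j \<le> l" "i \<le> Suc l" for i j
  proof -
    \<comment> \<open>In these ranges no subtraction is truncated, so the exponents really add
      up.\<close>
    have "2 * l + 1 - (j + i) = (Suc l - i) + (l - j)" using that by simp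
    then show ?thesis by (simp only: power_add) (simp add: algebra_simps)
  qed
  then have coef': "(-1) ^ i * q ^ (Suc l - i) * ((-1) ^ j * q ^ (l - j)) = ?c i j" if "j \<le> l" "i \<le> Suc l" for i j
    using that by (simp only: add.commute[of i j])
  have "rstar R q (Suc l) (lstar R q l u x) v = (\<Sum>b\<le>Suc l. \<Sum>a\<le>l. ?G b a)"
    unfolding rstar_def lstar_def tmul_sum_left rword_sum tmul_scl_left rword_scl scl_sum scl_scl
  proof (intro sum.cong refl)
    fix b a assume ba: "b \<in> {..Suc l}" "a \<in> {..l}"
    have "set (desc a) \<subseteq> {1..<Suc l}" using ba by auto
    then have "tmul (Suc l) (rword (Suc l) R (desc a) (tmul 1 u x)) v = rword m R (desc a) X"
      using rword_tmul_left[OF ux v] by (simp add: X m)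
    then show "scl ((- 1) ^ b * q ^ (Suc l - b) * ((- 1) ^ a * q ^ (l - a)))
        (rword (Suc (Suc l)) R [Suc (Suc l) - b..<Suc (Suc l)]
           (tmul (Suc l) (rword (Suc l) R (desc a) (tmul 1 u x)) v)) = ?G b a"
      using ba by (simp only: coef atMost_iff m)
  qed
  moreover have "lstar R q (Suc l) u (rstar R q l x v) = (\<Sum>a\<le>Suc l. \<Sum>b\<le>l. ?F a b)"
    unfolding rstar_def lstar_def tmul_sum_right rword_sum tmul_scl_right rword_scl scl_sum scl_scl
  proof (intro sum.cong refl)
    fix b a assume ba: "b \<in> {..l}" "a \<in> {..Suc l}"
    have w: "[m - b..<m] = map Suc [Suc l - b..<Suc l]"
      using ba by (simp add: m map_Suc_upt Suc_diff_le del: upt_Suc)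
    have "rword (1 + Suc l) R [m - b..<m] X
        = tmul 1 u (rword (Suc l) R (map (\<lambda>i. i - 1) [m - b..<m]) (tmul l x v))"
      unfolding X_def using ba by (intro rword_tmul_right[OF u xv]) (auto simp: m)
    also have "map (\<lambda>i. i - 1) [m - b..<m] = [Suc l - b..<Suc l]"
      unfolding w by (simp only: map_map o_def diff_Suc_1 list.map_ident)
    finally have "tmul 1 u (rword (Suc l) R [Suc l - b..<Suc l] (tmul l x v)) = rword m R [m - b..<m] X"
      by (simp only: m plus_1_eq_Suc)
    then show "scl ((- 1) ^ a * q ^ (Suc l - a) * ((- 1) ^ b * q ^ (l - b)))
        (rword (Suc (Suc l)) R (desc a)
           (tmul 1 u (rword (Suc l) R [Suc l - b..<Suc l] (tmul l x v)))) = ?F a b"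
      using ba by (simp only: coef' atMost_iff m)
  qed
  \<comment> \<open>The matching follows the two cases of
    \<open>descending_ascending_commute\<close>: far pairs stay, crossing pairs (a, b) become (a -
    1, b + 1). This also exchanges the two ranges.\<close>
  moreover have "(\<Sum>(a, b)\<in>{..Suc l} \<times> {..l}. ?F a b) = (\<Sum>(b, a)\<in>{..Suc l} \<times> {..l}. ?G b a)"
  proof (rule sum.reindex_bij_witness[where
        i = "\<lambda>(b, a). if a + b \<le> l then (a, b) else (Suc a, b - 1)"
        and j = "\<lambda>(a, b). if a + b \<le> l then (b, a) else (Suc b, a - 1)"])
    fix p assume "p \<in> {..Suc l} \<times> {..l}"
    then obtain a b where p: "p = (a, b)" "a \<le> Suc l" "b \<le> l" by auto
    have "?F a b = (if a + b \<le> l then ?G b a else ?G (Suc b) (a - 1))"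
      using descending_ascending_commute[OF p(2,3) m, of X] p(2,3) by simp
    then show "(case case p of (a, b) \<Rightarrow> if a + b \<le> l then (b, a) else (Suc b, a - 1) of (b, a) \<Rightarrow> ?G b a)
        = (case p of (a, b) \<Rightarrow> ?F a b)"
      by (simp add: p(1))
  qed (auto split: if_splits)
  ultimately show ?thesis by (simp only: sum.cartesian_product)
qed

end

section \<open>Moving vectors past the top form\<close>

text \<open>The defining equation of \<theta>, kept as a relation between \<open>v\<close> and
  \<open>w\<close> rather than through an operator, so that it can be transferred to
  \<open>opp R\<close> and the reversed form before \<theta> is known to be invertible.\<close>

definition moves :: "('n::finite \<Rightarrow> 'n \<Rightarrow> 'n \<Rightarrow> 'n \<Rightarrow> 'k::field) \<Rightarrow> nat \<Rightarrow> ('n, 'k) tensor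
    \<Rightarrow> ('n \<Rightarrow> 'k) \<Rightarrow> ('n \<Rightarrow> 'k) \<Rightarrow> bool" where
  "moves R n t v w \<longleftrightarrow> rword (Suc n) R (desc n) (tmul 1 (vec1 v) t) = tmul n t (vec1 w)"

text \<open>The entries of $(q - R)(u \otimes w)$.\<close>

definition qR :: "('n::finite \<Rightarrow> 'n \<Rightarrow> 'n \<Rightarrow> 'n \<Rightarrow> 'k::field) \<Rightarrow> 'k \<Rightarrow> ('n \<Rightarrow> 'k) \<Rightarrow> ('n \<Rightarrow> 'k) \<Rightarrow> 'n \<Rightarrow> 'n \<Rightarrow> 'k" where
  "qR R q u w i j = q * u i * w j - (\<Sum>a\<in>UNIV. \<Sum>b\<in>UNIV. R i j a b * u a * w b)"

text \<open>Only the term with the longest word touches the last slot. In all others the contraction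
  reaches \<open>b\<close>, and their coefficients are \<open>q\<close> times those of the product
  in one degree less.\<close>

lemma rcon_lstar:
  assumes v: "v \<in> Tens 1" and b: "b \<in> Tens (Suc m)"
  shows "rcon x (lstar R q (Suc m) v b) = scl q (lstar R q m v (rcon x b))
    + scl ((-1) ^ Suc m) (rcon x (rword (Suc (Suc m)) R (desc (Suc m)) (tmul 1 v b)))"
proof -
  have "rcon x (rword (Suc (Suc m)) R (desc k) (tmul 1 v b)) = rword (Suc m) R (desc k) (tmul 1 v (rcon x b))"
    if "k \<le> m" for k
  proof -
    have "set (desc k) \<subseteq> {1..<Suc m}" using that by auto
    then show ?thesis by (simp only: rcon_rword rcon_tmul[OF v b])
  qed
  then have "(\<Sum>k\<le>m. scl ((-1) ^ k * q ^ (Suc m - k)) (rcon x (rword (Suc (Suc m)) R (desc k) (tmul 1 v b))))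
      = scl q (lstar R q m v (rcon x b))"
    unfolding lstar_def scl_sum by (intro sum.cong refl) (simp add: Suc_diff_le mult.left_commute)
  then show ?thesis
    by (simp only: lstar_def[of R q "Suc m"] rcon_add rcon_sum rcon_scl sum.atMost_Suc diff_self_eq_0 power_0 mult_1_right)
qed

context hecke
begin

lemma lstar_rcon:
  assumes "t \<in> Tens (Suc m)" "lstar R q (Suc m) (vec1 v) t = 0" "moves R (Suc m) t v w"
  shows "scl q (lstar R q m (vec1 v) (rcon x t)) = scl ((-1) ^ m * w x) t"
proof -
  have "scl q (lstar R q m (vec1 v) (rcon x t)) + scl ((-1) ^ Suc m) (scl (w x) t) = 0"
    using rcon_lstar[OF Tens_vec1 assms(1), of x R q v] assms(2,3) rcon_tmul_vec1[OF assms(1), of x w]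
    by (simp add: moves_def)
  then show ?thesis by (simp add: fun_eq_iff)
qed

text \<open>The analogue of \<open>lstar_rcon\<close> for two contracted slots. It involves
  \<open>A_(n-1)(vt)\<close> with \<open>n = Suc (Suc m)\<close>, where \<open>v\<close> has passed
  all but the last factor of \<open>t\<close>. This tensor is recovered from \<open>t w\<close> by
  undoing \<open>R_n\<close>, which is how \<open>R\<close> enters the result.\<close>

lemma lstar_lstar_rcon:
  assumes t: "t \<in> Tens (Suc (Suc m))"
    and v: "lstar R q (Suc (Suc m)) (vec1 v) t = 0" "moves R (Suc (Suc m)) t v w"
    and u: "lstar R q (Suc (Suc m)) (vec1 u) t = 0" "moves R (Suc (Suc m)) t u z"
  shows "scl (q ^ 3) (lstar R q (Suc m) (vec1 u) (lstar R q m (vec1 v) (rcon i (rcon j t))))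
    = scl (qR R q z w i j) t"
proof -
  let ?n = "Suc (Suc m)" and ?e = "(-1) ^ Suc m :: 'k"
  define s where "s = rword (Suc ?n) R (desc (Suc m)) (tmul 1 (vec1 v) t)"
  have vt: "tmul 1 (vec1 v) t \<in> Tens (Suc ?n)" using Tens_tmul[OF Tens_vec1 t] by simp
  have Ts: "Rop (Suc ?n) ?n R s = tmul ?n t (vec1 w)"
    using v(2) by (simp add: moves_def s_def)
  have "Rop (Suc ?n) ?n R (Rop (Suc ?n) ?n R s) = scl (q - 1) (Rop (Suc ?n) ?n R s) + scl q s"
    using vt by (intro Rop_Rop) (auto simp: s_def)
  \<comment> \<open>The quadratic relation gives \<open>q\<close> times the inverse of
    \<open>R_n\<close> as \<open>R_n - (q - 1)\<close>.\<close>
  then have qs: "scl q s = Rop (Suc ?n) ?n R (tmul ?n t (vec1 w)) - scl (q - 1) (tmul ?n t (vec1 w))"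
    by (simp add: Ts)
  have "rcon i (rcon j (Rop (Suc ?n) ?n R (tmul ?n t (vec1 w))))
      = (\<Sum>a\<in>UNIV. \<Sum>b\<in>UNIV. scl (R i j a b * w b) (rcon a t))"
  proof
    fix ys
    show "rcon i (rcon j (Rop (Suc ?n) ?n R (tmul ?n t (vec1 w)))) ys
        = (\<Sum>a\<in>UNIV. \<Sum>b\<in>UNIV. scl (R i j a b * w b) (rcon a t)) ys"
    proof (cases "length ys = Suc m")
      case True
      then have "(ys @ [i, j])[Suc m := a, ?n := b] = (ys @ [a]) @ [b]" for a b
        by (simp add: list_update_append)
      moreover have "tmul ?n t (vec1 w) ((ys @ [a]) @ [b]) = t (ys @ [a]) * w b" for a b
        using True by (intro tmul_vec1_snoc) simp
      ultimately show ?thesis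
        using True by (simp add: rcon_def Rop_def nth_append sum_fun_apply mult_ac)
    next
      case False
      then show ?thesis using t by (simp add: rcon_def Rop_def sum_fun_apply Tens_iff)
    qed
  qed
  then have rs: "scl q (rcon i (rcon j s))
      = (\<Sum>a\<in>UNIV. \<Sum>b\<in>UNIV. scl (R i j a b * w b) (rcon a t)) - scl ((q - 1) * w j) (rcon i t)"
    using arg_cong[OF qs, of "\<lambda>f. rcon i (rcon j f)"]
    by (simp only: rcon_scl rcon_diff rcon_tmul_vec1[OF t] scl_scl)
  have "rcon i (rcon j s) = rcon i (rword ?n R (desc (Suc m)) (tmul 1 (vec1 v) (rcon j t)))"
    unfolding s_def by (subst rcon_rword) (auto simp: rcon_tmul[OF Tens_vec1_Suc t])
  then have r: "rcon i (lstar R q (Suc m) (vec1 v) (rcon j t))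
      = scl q (lstar R q m (vec1 v) (rcon i (rcon j t))) + scl ?e (rcon i (rcon j s))"
    using rcon_lstar[OF Tens_vec1 Tens_rcon[OF t], of i R q v j] by simp
  have l: "scl q (lstar R q (Suc m) (vec1 v) (rcon j t)) = scl (?e * w j) t"
    by (rule lstar_rcon[OF t v])
  let ?D = "\<Sum>a\<in>UNIV. \<Sum>b\<in>UNIV. scl (R i j a b * w b) (rcon a t)"
  have "scl (q * q) (lstar R q m (vec1 v) (rcon i (rcon j t))) = scl ?e (scl (q * w j) (rcon i t) - ?D)"
  proof
    fix ys
    have alg: "q * q * l = e * (q * c * b - d)"
      if "q * a = e * c * b" "a = q * l + e * r" "q * r = d - (q - 1) * c * b" for a b c d e l r :: 'k
      using that by algebra
    have "q * rcon i (lstar R q (Suc m) (vec1 v) (rcon j t)) ys = ?e * w j * rcon i t ys"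
      using fun_cong[OF arg_cong[OF l, of "rcon i"], of ys] by (simp only: rcon_scl scl_apply)
    then show "scl (q * q) (lstar R q m (vec1 v) (rcon i (rcon j t))) ys
        = scl ?e (scl (q * w j) (rcon i t) - ?D) ys"
      using fun_cong[OF r, of ys] fun_cong[OF rs, of ys]
      unfolding scl_apply plus_fun_apply minus_apply by (rule alg)
  qed
  from arg_cong[OF this, of "lstar R q (Suc m) (vec1 u)"]
  have *: "scl (q * q) (lstar R q (Suc m) (vec1 u) (lstar R q m (vec1 v) (rcon i (rcon j t))))
    = scl ?e (scl (q * w j) (lstar R q (Suc m) (vec1 u) (rcon i t))
      - (\<Sum>a\<in>UNIV. \<Sum>b\<in>UNIV. scl (R i j a b * w b) (lstar R q (Suc m) (vec1 u) (rcon a t))))"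
    by (simp only: lstar_scl_right lstar_diff_right lstar_sum_right)
  show ?thesis
  proof
    fix ys
    let ?X = "lstar R q (Suc m) (vec1 u) (lstar R q m (vec1 v) (rcon i (rcon j t))) ys"
    let ?L = "\<lambda>a. lstar R q (Suc m) (vec1 u) (rcon a t) ys"
    have L: "q * ?L a = ?e * z a * t ys" for a
      using fun_cong[OF lstar_rcon[OF t u, of a], of ys] by (simp only: scl_apply)
    \<comment> \<open>Two factors \<open>q\<close> come from contracting two slots in the product
      with \<open>v\<close>, the third from contracting one slot in the product with
      \<open>u\<close>.\<close>
    have "q ^ 3 * ?X = q * (q * q * ?X)"
      by (simp add: power3_eq_cube mult.assoc)
    also have "\<dots> = q * (?e * (q * w j * ?L i - (\<Sum>a\<in>UNIV. \<Sum>b\<in>UNIV. R i j a b * w b * ?L a)))"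
      using fun_cong[OF *, of ys] by (simp only: scl_apply minus_apply sum_fun_apply)
    also have "\<dots> = ?e * (q * w j * (q * ?L i) - (\<Sum>a\<in>UNIV. \<Sum>b\<in>UNIV. R i j a b * w b * (q * ?L a)))"
      by (simp add: algebra_simps sum_distrib_left)
    also have "\<dots> = ?e * ?e * (qR R q z w i j * t ys)"
      unfolding L qR_def by (simp add: algebra_simps sum_distrib_left sum_distrib_right del: power_Suc)
    also have "?e * ?e = 1"
      by (simp flip: power_add)
    finally show "scl (q ^ 3) (lstar R q (Suc m) (vec1 u) (lstar R q m (vec1 v) (rcon i (rcon j t)))) ys
        = scl (qR R q z w i j) t ys"
      by simp
  qed
qed

text \<open>For smaller k the product \<open>T_1 ... T_k T_k ... T_1\<close> differs from
  \<open>q^(k+1)\<close> on \<open>vt\<close> by q - 1 times the partial alternating sum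
  \<open>S k\<close>. At k = n this sum is v \<star> t, which vanishes.\<close>

lemma ascending_descending_top:
  assumes t: "t \<in> Ups R q n" and v: "v \<in> Tens 1" and "lstar R q n v t = 0"
  shows "rword (Suc n) R [1..<Suc n] (rword (Suc n) R (desc n) (tmul 1 v t)) = scl (q ^ Suc n) (tmul 1 v t)"
proof -
  define X where "X = tmul 1 v t"
  have X: "X \<in> Tens (Suc n)" using Tens_tmul[OF v Ups_Tens[OF t]] by (simp add: X_def)
  define S where "S k = (\<Sum>j\<le>k. scl ((-1) ^ j * q ^ (k - j)) (rword (Suc n) R (desc j) X))" for k
  have "rword (Suc n) R [1..<Suc k] (rword (Suc n) R (desc k) X) = scl (q ^ Suc k) X - scl (q - 1) (S k)"
    if "k \<le> n" for k
    using that
  proof (induction k)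
    case 0
    then show ?case by (simp add: S_def fun_eq_iff algebra_simps)
  next
    case (Suc k)
    let ?D = "rword (Suc n) R (desc (Suc k)) X"
    \<comment> \<open>On \<open>vt\<close> the letters 2, ..., k + 1 act on \<open>t\<close> alone,
      each by -1 because \<open>t\<close> lies in \<Upsilon>.\<close>
    have shift: "rword (Suc n) R (map Suc [1..<Suc k]) X = scl ((-1) ^ k) X"
    proof -
      have "rword (1 + n) R (map Suc [1..<Suc k]) X
          = tmul 1 v (rword n R (map (\<lambda>i. i - 1) (map Suc [1..<Suc k])) t)"
        unfolding X_def using Suc.prems by (intro rword_tmul_right[OF v Ups_Tens[OF t]]) auto
      also have "map (\<lambda>i. i - 1) (map Suc [1..<Suc k]) = [1..<Suc k]"
        by (simp only: map_map o_def diff_Suc_1 list.map_ident)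
      also have "rword n R [1..<Suc k] t = scl ((-1) ^ length [1..<Suc k]) t"
        using Suc.prems by (intro rword_Ups[OF t]) auto
      finally show ?thesis by (simp only: plus_1_eq_Suc length_upt diff_Suc_1 tmul_scl_right X_def)
    qed
    have "rword (Suc n) R [1..<Suc k] ?D = rword (Suc n) R (desc (Suc k)) (rword (Suc n) R (map Suc [1..<Suc k]) X)"
      using Suc.prems by (intro rword_descending) auto
    then have D: "rword (Suc n) R [1..<Suc k] ?D = scl ((-1) ^ k) ?D"
      by (simp only: shift rword_scl)
    have "Rop (Suc n) (Suc k) R ?D = scl (q - 1) ?D + scl q (rword (Suc n) R (desc k) X)"
      using Rop_Rop[of "Suc k" "Suc n" "rword (Suc n) R (desc k) X"] X Suc.prems by simp
    then have "rword (Suc n) R [1..<Suc (Suc k)] ?D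
        = scl (q - 1) (rword (Suc n) R [1..<Suc k] ?D)
          + scl q (rword (Suc n) R [1..<Suc k] (rword (Suc n) R (desc k) X))"
      using upt_Suc_append[of 1 "Suc k"] by (simp only: rword_append rword_Cons rword_Nil rword_add rword_scl)
    also have "\<dots> = scl (q - 1) (scl ((-1) ^ k) ?D) + scl q (scl (q ^ Suc k) X - scl (q - 1) (S k))"
      using Suc by (simp only: D)
    also have "\<dots> = scl (q ^ Suc (Suc k)) X - scl (q - 1) (S (Suc k))"
    proof -
      have "S (Suc k) = scl q (S k) + scl ((-1) ^ Suc k) ?D"
        unfolding S_def scl_sum sum.atMost_Suc
        by (intro arg_cong2[where f = "(+)"] sum.cong refl) (simp_all add: Suc_diff_le mult_ac)
      then show ?thesis by (simp only:) (simp add: fun_eq_iff algebra_simps)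
    qed
    finally show ?case .
  qed
  from this[of n] show ?thesis
    using assms(3) by (simp add: S_def lstar_def X_def)
qed

end

context hecke
begin

text \<open>Read from right to left, the Jucys-Murphy identity says that the ascending word carries
  \<open>t w\<close> back to \<open>q^(n+1) u t\<close>. Reversal turns that word into
  \<open>desc n\<close>.\<close>

lemma moves_opp:
  assumes t: "t \<in> Ups R q n" and "lstar R q n (vec1 u) t = 0" "moves R n t u w"
  shows "moves (opp R) n (mirror t) w (\<lambda>i. q ^ Suc n * u i)"
proof -
  have "rword (Suc n) R [1..<Suc n] (tmul n t (vec1 w)) = scl (q ^ Suc n) (tmul 1 (vec1 u) t)"
    using ascending_descending_top[OF t Tens_vec1 assms(2)] assms(3) by (simp only: moves_def)
  then have "rword (Suc n) R [1..<Suc n] (tmul n t (vec1 w)) = tmul 1 (vec1 (\<lambda>i. q ^ Suc n * u i)) t"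
    by (simp add: tmul_def vec1_def fun_eq_iff split: list.splits)
  from arg_cong[OF this, of mirror] show ?thesis
    using mirror_tmul[OF Ups_Tens[OF t] Tens_vec1, of w] map_reflect_ascending[of n n]
    by (subst (asm) mirror_rword) (simp_all add: moves_def mirror_tmul[OF Tens_vec1_Suc Ups_Tens[OF t]] del: upt_Suc)
qed

text \<open>This is \<open>lstar_rcon\<close> for \<open>opp R\<close> and the reversed
  \<open>t\<close>. The multiplying vector has to be the result \<open>w\<close> of a move, and the
  value involves the vector \<open>u\<close> that was moved.\<close>

lemma rstar_lcon:
  assumes t: "t \<in> Ups R q (Suc m)"
    and l: "lstar R q (Suc m) (vec1 u) t = 0" "moves R (Suc m) t u w"
    and r: "rstar R q (Suc m) t (vec1 w) = 0"
  shows "scl q (rstar R q m (lcon x t) (vec1 w)) = scl ((-1) ^ m * (q ^ Suc (Suc m) * u x)) t"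
proof -
  interpret o: hecke "opp R" q by standard (rule hecke_symmetry_opp[OF hecke_symmetry])
  have T: "t \<in> Tens (Suc m)" by (rule Ups_Tens[OF t])
  have "lstar (opp R) q (Suc m) (vec1 w) (mirror t) = 0"
    using mirror_rstar[OF T Tens_vec1, of R q w] r by simp
  then have "scl q (lstar (opp R) q m (vec1 w) (rcon x (mirror t))) = scl ((-1) ^ m * (q ^ Suc (Suc m) * u x)) (mirror t)"
    using T by (intro o.lstar_rcon moves_opp[OF t l]) auto
  then have "mirror (scl q (rstar R q m (lcon x t) (vec1 w))) = mirror (scl ((-1) ^ m * (q ^ Suc (Suc m) * u x)) t)"
    using mirror_rstar[OF Tens_lcon[OF T] Tens_vec1, of R q x w] by (simp only: mirror_scl mirror_lcon mirror_vec1)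
  then show ?thesis by (simp only: mirror_eq_iff)
qed

lemma rstar_rstar_lcon:
  assumes t: "t \<in> Ups R q (Suc (Suc m))"
    and u: "lstar R q (Suc (Suc m)) (vec1 u) t = 0" "moves R (Suc (Suc m)) t u w"
    and u': "lstar R q (Suc (Suc m)) (vec1 u') t = 0" "moves R (Suc (Suc m)) t u' w'"
    and r: "\<And>v. rstar R q (Suc (Suc m)) t (vec1 v) = 0"
  shows "scl (q ^ 3) (rstar R q (Suc m) (rstar R q m (lcon j (lcon i t)) (vec1 w)) (vec1 w'))
    = scl ((q ^ Suc (Suc (Suc m)))\<^sup>2 * qR R q u u' i j) t"
proof -
  interpret o: hecke "opp R" q by standard (rule hecke_symmetry_opp[OF hecke_symmetry])
  let ?Q = "q ^ Suc (Suc (Suc m))"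
  have T: "t \<in> Tens (Suc (Suc m))" by (rule Ups_Tens[OF t])
  have l: "lstar (opp R) q (Suc (Suc m)) (vec1 v) (mirror t) = 0" for v
    using mirror_rstar[OF T Tens_vec1, of R q v] r by simp
  have *: "scl (q ^ 3) (lstar (opp R) q (Suc m) (vec1 w') (lstar (opp R) q m (vec1 w) (rcon j (rcon i (mirror t)))))
      = scl (qR (opp R) q (\<lambda>i. ?Q * u' i) (\<lambda>i. ?Q * u i) j i) (mirror t)"
    using T by (intro o.lstar_lstar_rcon l moves_opp[OF t u] moves_opp[OF t u']) auto
  \<comment> \<open>Reversal exchanges the two vectors and the two slots, and \<open>opp\<close>
    exchanges the indices of \<open>R\<close>, so q - R itself reappears; each vector contributes
    one factor \<open>?Q\<close>.\<close>
  have "qR (opp R) q (\<lambda>i. ?Q * u' i) (\<lambda>i. ?Q * u i) j i = ?Q\<^sup>2 * qR R q u u' i j"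
  proof -
    have "(\<Sum>a\<in>UNIV. \<Sum>b\<in>UNIV. opp R j i a b * (?Q * u' a) * (?Q * u b))
        = (\<Sum>b\<in>UNIV. \<Sum>a\<in>UNIV. R i j b a * (?Q * u' a) * (?Q * u b))"
      unfolding opp_def by (rule sum.swap)
    also have "\<dots> = ?Q\<^sup>2 * (\<Sum>a\<in>UNIV. \<Sum>b\<in>UNIV. R i j a b * u a * u' b)"
      by (simp add: sum_distrib_left power2_eq_square mult_ac del: power_Suc)
    finally show ?thesis
      by (simp add: qR_def algebra_simps power2_eq_square del: power_Suc)
  qed
  moreover have x: "lcon j (lcon i t) \<in> Tens m" using T by simp
  moreover have "rstar R q m (lcon j (lcon i t)) (vec1 w) \<in> Tens (Suc m)"
    by (rule Ups_Tens[OF rstar_Ups[OF lcon_Ups[OF lcon_Ups[OF t]] Tens_vec1]])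
  ultimately have "mirror (scl (q ^ 3) (rstar R q (Suc m) (rstar R q m (lcon j (lcon i t)) (vec1 w)) (vec1 w')))
      = mirror (scl (?Q\<^sup>2 * qR R q u u' i j) t)"
    using * by (simp only: mirror_scl mirror_rstar Tens_vec1 mirror_vec1 mirror_lcon)
  then show ?thesis by (simp only: mirror_eq_iff)
qed

end

section \<open>Operators on $V$ commuting with $R$\<close>

definition ebasis :: "'n list \<Rightarrow> ('n, 'k::field) tensor" where
  "ebasis zs = (\<lambda>xs. if xs = zs then 1 else 0)"

definition commutes_R :: "('n::finite \<Rightarrow> 'n \<Rightarrow> 'n \<Rightarrow> 'n \<Rightarrow> 'k::field) \<Rightarrow> ('n \<Rightarrow> 'n \<Rightarrow> 'k) \<Rightarrow> bool" where
  "commutes_R R M \<longleftrightarrow> (\<forall>f\<in>Tens 2. tsq M (Rop 2 1 R f) = Rop 2 1 R (tsq M f))"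

lemma ebasis_Tens [simp]: "ebasis zs \<in> Tens (length zs)"
  by (simp add: ebasis_def Tens_iff)

lemma Tens_tsq [simp]: "tsq M f \<in> Tens 2"
  by (auto simp: tsq_def Tens_iff)

lemma tsq_apply: "tsq M f [x, y] = (\<Sum>a\<in>UNIV. \<Sum>b\<in>UNIV. M x a * M y b * f [a, b])"
  by (simp add: tsq_def)

lemma Rop_2_apply: "Rop 2 1 R f [x, y] = (\<Sum>a\<in>UNIV. \<Sum>b\<in>UNIV. R x y a b * f [a, b])"
  by (simp add: Rop_def)

lemma Tens_2_eqI:
  assumes "f \<in> Tens 2" "g \<in> Tens 2" "\<And>x y. f [x, y] = g [x, y]"
  shows "f = g"
proof
  fix xs
  show "f xs = g xs"
  proof (cases "length xs = 2")
    case True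
    then obtain x y where "xs = [x, y]" by (auto simp: numeral_2_eq_2 length_Suc_conv)
    then show ?thesis by (simp add: assms(3))
  qed (use assms(1,2) in \<open>simp add: Tens_iff\<close>)
qed

lemma commutes_R_iff:
  "commutes_R R M \<longleftrightarrow> (\<forall>x y c d. (\<Sum>a\<in>UNIV. \<Sum>b\<in>UNIV. M x a * M y b * R a b c d)
    = (\<Sum>a\<in>UNIV. \<Sum>b\<in>UNIV. R x y a b * (M a c * M b d)))"
proof
  assume c: "commutes_R R M"
  show "\<forall>x y c d. (\<Sum>a\<in>UNIV. \<Sum>b\<in>UNIV. M x a * M y b * R a b c d)
    = (\<Sum>a\<in>UNIV. \<Sum>b\<in>UNIV. R x y a b * (M a c * M b d))"
  proof (intro allI)
    fix x y c d
    have e: "(ebasis [c, d] :: ('a, 'b) tensor) \<in> Tens 2" using ebasis_Tens[of "[c, d]"] by (simp add: numeral_2_eq_2)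
    have "(\<Sum>a\<in>UNIV. \<Sum>b\<in>UNIV. g a b * ebasis [c, d] [a, b]) = g c d" for g :: "'a \<Rightarrow> 'a \<Rightarrow> 'b"
    proof -
      have "(\<Sum>b\<in>UNIV. g a b * ebasis [c, d] [a, b]) = (if a = c then g a d else 0)" for a
        by (simp add: ebasis_def if_distrib cong: if_cong)
      then show ?thesis by simp
    qed
    moreover have "tsq M (Rop 2 1 R (ebasis [c, d])) [x, y] = Rop 2 1 R (tsq M (ebasis [c, d])) [x, y]"
      using c e by (simp add: commutes_R_def)
    ultimately show "(\<Sum>a\<in>UNIV. \<Sum>b\<in>UNIV. M x a * M y b * R a b c d)
        = (\<Sum>a\<in>UNIV. \<Sum>b\<in>UNIV. R x y a b * (M a c * M b d))"
      by (simp only: tsq_apply Rop_2_apply)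
  qed
next
  assume *: "\<forall>x y c d. (\<Sum>a\<in>UNIV. \<Sum>b\<in>UNIV. M x a * M y b * R a b c d)
    = (\<Sum>a\<in>UNIV. \<Sum>b\<in>UNIV. R x y a b * (M a c * M b d))"
  show "commutes_R R M"
    unfolding commutes_R_def
  proof (intro ballI Tens_2_eqI)
    fix f :: "('a, 'b) tensor" and x y
    have "tsq M (Rop 2 1 R f) [x, y]
        = (\<Sum>a\<in>UNIV. \<Sum>b\<in>UNIV. \<Sum>c\<in>UNIV. \<Sum>d\<in>UNIV. M x a * M y b * R a b c d * f [c, d])"
      by (simp only: tsq_apply Rop_2_apply sum_distrib_left mult.assoc)
    also have "\<dots> = (\<Sum>c\<in>UNIV. \<Sum>d\<in>UNIV. (\<Sum>a\<in>UNIV. \<Sum>b\<in>UNIV. M x a * M y b * R a b c d) * f [c, d])"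
      by (subst sum_swap_pairs) (simp only: sum_distrib_right)
    also have "\<dots> = (\<Sum>c\<in>UNIV. \<Sum>d\<in>UNIV. \<Sum>a\<in>UNIV. \<Sum>b\<in>UNIV. R x y a b * (M a c * M b d) * f [c, d])"
      by (simp only: * sum_distrib_right)
    also have "\<dots> = (\<Sum>a\<in>UNIV. \<Sum>b\<in>UNIV. \<Sum>c\<in>UNIV. \<Sum>d\<in>UNIV. R x y a b * (M a c * M b d) * f [c, d])"
      by (rule sum_swap_pairs)
    also have "\<dots> = Rop 2 1 R (tsq M f) [x, y]"
      by (simp only: tsq_apply Rop_2_apply sum_distrib_left mult.assoc)
    finally show "tsq M (Rop 2 1 R f) [x, y] = Rop 2 1 R (tsq M f) [x, y]" .
  qed auto
qed

section \<open>Matrices on V and their inverses\<close>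

definition idm :: "'n \<Rightarrow> 'n \<Rightarrow> 'k::field" where
  "idm = (\<lambda>i j. if i = j then 1 else 0)"

lemma mv_mm: "mv (mm A B) v = mv A (mv B v)"
  unfolding mv_def mm_def sum_distrib_right sum_distrib_left
  by (rule ext, subst sum.swap) (simp add: mult.assoc)

definition unit_vec :: "'n \<Rightarrow> 'n \<Rightarrow> 'k::field" where
  "unit_vec j = (\<lambda>i. if i = j then 1 else 0)"

lemma mv_unit_vec: "mv M (unit_vec j) = (\<lambda>i. M i j)"
  by (simp add: mv_def unit_vec_def if_distrib[of "\<lambda>c. _ * c"] cong: if_cong)

lemma mv_idm: "mv idm v = v"
  by (simp add: mv_def idm_def if_distrib[of "\<lambda>c. c * _"] cong: if_cong)

lemma matrix_eqI: "(\<And>v. mv A v = mv B v) \<Longrightarrow> A = B"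
  by (metis (no_types) mv_unit_vec ext)

lemma tsq_mm: "tsq (mm A B) f = tsq A (tsq B f)"
proof (rule Tens_2_eqI)
  fix x y
  have "tsq (mm A B) f [x, y]
      = (\<Sum>c\<in>UNIV. \<Sum>d\<in>UNIV. \<Sum>a\<in>UNIV. \<Sum>b\<in>UNIV. A x a * A y b * (B a c * B b d * f [c, d]))"
    by (simp only: tsq_apply mm_def sum_product) (simp only: sum_distrib_right, simp only: mult_ac)
  also have "\<dots> = tsq A (tsq B f) [x, y]"
    by (subst sum_swap_pairs) (simp only: tsq_apply sum_distrib_left)
  finally show "tsq (mm A B) f [x, y] = tsq A (tsq B f) [x, y]" .
qed auto

lemma tsq_scale: "tsq (\<lambda>i j. c * M i j) f = scl (c\<^sup>2) (tsq M f)"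
  by (auto simp: tsq_def fun_eq_iff sum_distrib_left power2_eq_square mult_ac)

lemma tsq_idm:
  assumes "f \<in> Tens 2"
  shows "tsq idm f = f"
proof (rule Tens_2_eqI)
  fix x y
  have "(\<Sum>b\<in>UNIV. idm x a * idm y b * f [a, b]) = (if x = a then f [a, y] else 0)" for a
    by (cases "x = a") (simp_all add: idm_def if_distrib[of "\<lambda>c. c * _"] cong: if_cong)
  then show "tsq idm f [x, y] = f [x, y]" by (simp add: tsq_apply)
qed (use assms in auto)

lemma commutes_R_mm: "commutes_R R A \<Longrightarrow> commutes_R R B \<Longrightarrow> commutes_R R (mm A B)"
  by (simp add: commutes_R_def tsq_mm)

lemma commutes_R_scale: "commutes_R R A \<Longrightarrow> commutes_R R (\<lambda>i j. c * A i j)"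
  by (simp add: commutes_R_def tsq_scale Rop_scl)

lemma commutes_R_inverse:
  assumes A: "commutes_R R A" and "mm A B = idm" "mm B A = idm"
  shows "commutes_R R B"
  unfolding commutes_R_def
proof
  fix f :: "('a, 'b) tensor" assume f: "f \<in> Tens 2"
  have AB: "tsq A (tsq B f) = f" and BA: "tsq B (tsq A g) = g" if "g \<in> Tens 2" for g
    using f that assms(2,3) by (simp_all add: tsq_idm flip: tsq_mm)
  have "tsq A (Rop 2 1 R (tsq B f)) = Rop 2 1 R f"
    using A AB[OF f] unfolding commutes_R_def by simp
  then have "tsq B (Rop 2 1 R f) = tsq B (tsq A (Rop 2 1 R (tsq B f)))" by simp
  then show "tsq B (Rop 2 1 R f) = Rop 2 1 R (tsq B f)" by (simp only: BA Tens_Rop)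
qed

text \<open>Finite dimension enters here: the unit vectors are a finite basis of the coordinate
  space.\<close>

lemma mv_surj:
  fixes M :: "'n::finite \<Rightarrow> 'n \<Rightarrow> 'k::field"
  assumes "inj (mv M)"
  shows "surj (mv M)"
proof -
  interpret vector_space "scl :: 'k \<Rightarrow> ('n \<Rightarrow> 'k) \<Rightarrow> _" by (rule vector_space_scl)
  let ?B = "range unit_vec :: ('n \<Rightarrow> 'k) set"
  have inj: "inj (unit_vec :: 'n \<Rightarrow> 'n \<Rightarrow> 'k)"
    by (rule injI) (metis unit_vec_def zero_neq_one)
  have expand: "(\<Sum>j\<in>UNIV. scl (c j) (unit_vec j)) = c" for c :: "'n \<Rightarrow> 'k"
    by (simp add: fun_eq_iff sum_fun_apply unit_vec_def if_distrib[of "\<lambda>c. _ * c"] cong: if_cong)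
  have "independent ?B"
  proof (rule independent_if_scalars_zero)
    fix c x assume "(\<Sum>x\<in>?B. scl (c x) x) = 0" and "x \<in> ?B"
    then show "c x = 0"
      using expand[of "\<lambda>j. c (unit_vec j)"] by (auto simp: sum.reindex[OF inj] o_def fun_eq_iff)
  qed simp
  moreover have "span ?B = UNIV"
  proof -
    have "v \<in> span ?B" for v
      by (subst expand[of v, symmetric]) (intro span_sum span_scale span_base rangeI)
    then show ?thesis by blast
  qed
  ultimately interpret finite_dimensional_vector_space "scl :: 'k \<Rightarrow> ('n \<Rightarrow> 'k) \<Rightarrow> _" ?B
    by unfold_locales simp_all
  have "Vector_Spaces.linear scl scl (mv M)"
    by unfold_locales (auto simp: mv_def fun_eq_iff algebra_simps sum.distrib sum_distrib_left)
  then show ?thesis using assms by (rule linear_inj_imp_surj)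
qed

text \<open>Preimages of the unit vectors are the columns of a right inverse; injectivity makes it a
  left inverse too.\<close>

lemma matrix_inverse_exists:
  fixes M :: "'n::finite \<Rightarrow> 'n \<Rightarrow> 'k::field"
  assumes "\<And>v. mv M v = 0 \<Longrightarrow> v = 0"
  obtains N where "mm M N = idm" "mm N M = idm"
proof -
  have inj: "inj (mv M)"
  proof (rule injI)
    fix u v assume "mv M u = mv M v"
    then have "mv M (u - v) = 0"
      by (simp add: mv_def fun_eq_iff right_diff_distrib sum_subtractf)
    then show "u = v" using assms[of "u - v"] by simp
  qed
  then have "\<forall>j. \<exists>u. mv M u = unit_vec j" using mv_surj by (metis surjD)
  then obtain U where U: "mv M (U j) = unit_vec j" for j by metis
  let ?N = "\<lambda>i j. U j i"
  have MN: "mm M ?N = idm"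
    using U by (simp add: mm_def mv_def idm_def unit_vec_def fun_eq_iff)
  have "mv (mm ?N M) v = mv idm v" for v
  proof (rule injD[OF inj])
    have "mv M (mv (mm ?N M) v) = mv (mm M ?N) (mv M v)" by (simp only: mv_mm)
    then show "mv M (mv (mm ?N M) v) = mv M (mv idm v)" by (simp only: MN mv_idm)
  qed
  then show ?thesis by (intro that[OF MN] matrix_eqI)
qed

section \<open>Tensor powers of an operator\<close>

text \<open>The coefficient at \<open>xs\<close> of the tensor obtained by applying \<open>M\<close>
  in every slot. Recursion on the word takes the number of factors from its length and sums over one
  index at a time.\<close>

primrec pw_at :: "('n::finite \<Rightarrow> 'n \<Rightarrow> 'k::field) \<Rightarrow> 'n list \<Rightarrow> ('n, 'k) tensor \<Rightarrow> 'k" where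
  "pw_at M [] f = f []"
| "pw_at M (x # xs) f = (\<Sum>a\<in>UNIV. M x a * pw_at M xs (lcon a f))"

definition tpow :: "('n::finite \<Rightarrow> 'n \<Rightarrow> 'k::field) \<Rightarrow> ('n, 'k) tensor \<Rightarrow> ('n, 'k) tensor" where
  "tpow M f = (\<lambda>xs. pw_at M xs f)"

lemma tpow_apply: "tpow M f xs = pw_at M xs f"
  by (simp add: tpow_def)

lemma pw_at_cong:
  "(\<And>ys. length ys = length xs \<Longrightarrow> f ys = g ys) \<Longrightarrow> pw_at M xs f = pw_at M xs g"
proof (induction xs arbitrary: f g)
  case (Cons x xs)
  then have "pw_at M xs (lcon a f) = pw_at M xs (lcon a g)" for a
    by (intro Cons.IH) (simp add: lcon_def)
  then show ?case by simp
qed simp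

lemma lcon_add: "lcon x (f + g) = lcon x f + lcon x g"
  and lcon_scl: "lcon x (scl c f) = scl c (lcon x f)"
  and lcon_zero [simp]: "lcon x 0 = 0"
  by (simp_all add: lcon_def fun_eq_iff)

lemma lcon_sum: "lcon x (sum f A) = (\<Sum>i\<in>A. lcon x (f i))"
  by (simp add: lcon_def fun_eq_iff sum_fun_apply)

lemma pw_at_add: "pw_at M xs (f + g) = pw_at M xs f + pw_at M xs g"
  by (induction xs arbitrary: f g) (simp_all only: pw_at.simps lcon_add plus_fun_apply distrib_left sum.distrib)

lemma pw_at_scl: "pw_at M xs (scl c f) = c * pw_at M xs f"
  by (induction xs arbitrary: f) (simp_all add: lcon_scl sum_distrib_left mult.left_commute)

lemma pw_at_zero [simp]: "pw_at M xs 0 = 0"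
  using pw_at_scl[of M xs 0 0] by simp

lemma pw_at_sum: "pw_at M xs (sum f A) = (\<Sum>i\<in>A. pw_at M xs (f i))"
  using sum_comp_morphism[of "pw_at M xs" f A] by (simp add: pw_at_add o_def)

lemma pw_at_Tens:
  "f \<in> Tens p \<Longrightarrow> length xs \<noteq> p \<Longrightarrow> pw_at M xs f = 0"
  using pw_at_cong[of xs f 0 M] by (simp add: Tens_iff)

lemma Tens_tpow [simp]: "f \<in> Tens p \<Longrightarrow> tpow M f \<in> Tens p"
  by (subst Tens_iff) (simp add: tpow_apply pw_at_Tens)

lemma lcon_tpow: "lcon x (tpow M f) = (\<Sum>a\<in>UNIV. scl (M x a) (tpow M (lcon a f)))"
proof
  fix xs
  have "lcon x (tpow M f) xs = tpow M f (x # xs)" by (simp add: lcon_def)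
  then show "lcon x (tpow M f) xs = (\<Sum>a\<in>UNIV. scl (M x a) (tpow M (lcon a f))) xs"
    by (simp add: tpow_apply sum_fun_apply)
qed

lemma pw_at_snoc: "pw_at M (xs @ [x]) f = (\<Sum>a\<in>UNIV. M x a * pw_at M xs (rcon a f))"
proof (induction xs arbitrary: f)
  case Nil
  then show ?case by (simp add: lcon_def rcon_def)
next
  case (Cons y xs)
  have "pw_at M ((y # xs) @ [x]) f = (\<Sum>b\<in>UNIV. \<Sum>a\<in>UNIV. M y b * (M x a * pw_at M xs (rcon a (lcon b f))))"
    by (simp add: Cons.IH sum_distrib_left)
  also have "\<dots> = (\<Sum>a\<in>UNIV. \<Sum>b\<in>UNIV. M y b * (M x a * pw_at M xs (rcon a (lcon b f))))"
    by (rule sum.swap)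
  also have "\<dots> = (\<Sum>a\<in>UNIV. M x a * pw_at M (y # xs) (rcon a f))"
    by (simp add: sum_distrib_left rcon_def lcon_def mult.left_commute)
  finally show ?case .
qed

lemma lcon_Rop: "1 \<le> i \<Longrightarrow> lcon x (Rop (Suc p) (Suc i) R f) = Rop p i R (lcon x f)"
  by (cases i) (auto simp: lcon_def Rop_def fun_eq_iff)

lemma lcon_lcon_Rop:
  assumes "f \<in> Tens (Suc (Suc p))"
  shows "lcon y (lcon x (Rop (Suc (Suc p)) 1 R f))
    = (\<Sum>c\<in>UNIV. \<Sum>d\<in>UNIV. scl (R x y c d) (lcon d (lcon c f)))"
  using assms by (auto simp: lcon_def Rop_def fun_eq_iff sum_fun_apply Tens_iff)

lemma lcon_lcon_tpow:
  "lcon y (lcon x (tpow M f)) = (\<Sum>a\<in>UNIV. \<Sum>b\<in>UNIV. scl (M x a * M y b) (tpow M (lcon b (lcon a f))))"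
  by (simp only: lcon_tpow lcon_sum lcon_scl scl_sum scl_scl)

text \<open>Slots are peeled off from the left. For i > 1 this lowers the degree and the index
  together; only \<open>R_1\<close> calls for the entrywise commutation of \<open>M\<close>
  \<otimes> \<open>M\<close> with \<open>R\<close>, on the first two slots.\<close>

lemma tpow_Rop:
  assumes M: "commutes_R R M" and f: "f \<in> Tens p" and i: "1 \<le> i" "i < p"
  shows "tpow M (Rop p i R f) = Rop p i R (tpow M f)"
  using f i
proof (induction p arbitrary: i f)
  case (Suc p)
  have nil: "g [] = h []" if "g \<in> Tens (Suc p)" "h \<in> Tens (Suc p)" for g h :: "('a, 'b) tensor"
    using that by (simp add: Tens_iff)
  have "lcon x (tpow M (Rop (Suc p) i R f)) = lcon x (Rop (Suc p) i R (tpow M f))" for x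
  proof (cases "i = 1")
    case False
    then obtain j where j: "i = Suc j" "1 \<le> j" using Suc.prems by (cases i) auto
    then show ?thesis
      using Suc by (simp add: lcon_tpow lcon_Rop Rop_sum Rop_scl)
  next
    case True
    then obtain r where r: "p = Suc r" using Suc.prems by (cases p) auto
    have "lcon y (lcon x (tpow M (Rop (Suc p) i R f))) = lcon y (lcon x (Rop (Suc p) i R (tpow M f)))" for y
    proof
      fix zs
      let ?g = "\<lambda>c d. pw_at M zs (lcon d (lcon c f))"
      have "lcon y (lcon x (tpow M (Rop (Suc p) i R f))) zs
          = (\<Sum>a\<in>UNIV. \<Sum>b\<in>UNIV. \<Sum>c\<in>UNIV. \<Sum>d\<in>UNIV. M x a * M y b * R a b c d * ?g c d)"
        using Suc.prems(1)
        by (simp only: lcon_lcon_tpow True r lcon_lcon_Rop tpow_apply sum_fun_apply scl_apply pw_at_sum pw_at_scl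
            sum_distrib_left mult.assoc)
      also have "\<dots> = (\<Sum>c\<in>UNIV. \<Sum>d\<in>UNIV. (\<Sum>a\<in>UNIV. \<Sum>b\<in>UNIV. M x a * M y b * R a b c d) * ?g c d)"
        by (subst sum_swap_pairs) (simp only: sum_distrib_right)
      also have "\<dots> = (\<Sum>c\<in>UNIV. \<Sum>d\<in>UNIV. \<Sum>a\<in>UNIV. \<Sum>b\<in>UNIV. R x y a b * (M a c * M b d) * ?g c d)"
        using M by (simp only: commutes_R_iff sum_distrib_right)
      also have "\<dots> = (\<Sum>a\<in>UNIV. \<Sum>b\<in>UNIV. \<Sum>c\<in>UNIV. \<Sum>d\<in>UNIV. R x y a b * (M a c * M b d) * ?g c d)"
        by (rule sum_swap_pairs)
      also have "\<dots> = lcon y (lcon x (Rop (Suc p) i R (tpow M f))) zs"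
        using Tens_tpow[OF Suc.prems(1)[unfolded r], of M]
        by (simp only: True r lcon_lcon_Rop lcon_lcon_tpow tpow_apply sum_fun_apply scl_apply
            sum_distrib_left mult.assoc)
      finally show "lcon y (lcon x (tpow M (Rop (Suc p) i R f))) zs = lcon y (lcon x (Rop (Suc p) i R (tpow M f))) zs" .
    qed
    then have "tpow M (Rop (Suc p) i R f) (x # y # zs) = Rop (Suc p) i R (tpow M f) (x # y # zs)" for y zs
      unfolding lcon_def by meson
    moreover have "tpow M (Rop (Suc p) i R f) [x] = Rop (Suc p) i R (tpow M f) [x]"
      using Suc.prems Tens_tpow[OF Tens_Rop, of M "Suc p" i R f] Tens_Rop[of "Suc p" i R "tpow M f"] r by (simp add: Tens_iff)
    ultimately show ?thesis
      unfolding lcon_def by (metis neq_Nil_conv)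
  qed
  then have "tpow M (Rop (Suc p) i R f) (x # zs) = Rop (Suc p) i R (tpow M f) (x # zs)" for x zs
    unfolding lcon_def by meson
  then show ?case
    using nil[of "tpow M (Rop (Suc p) i R f)" "Rop (Suc p) i R (tpow M f)"] by (metis Tens_Rop Tens_tpow neq_Nil_conv ext)
qed simp

lemma tpow_rword:
  assumes "commutes_R R M" "f \<in> Tens p" "set w \<subseteq> {1..<p}"
  shows "tpow M (rword p R w f) = rword p R w (tpow M f)"
  using assms(3) by (induction w) (simp_all add: tpow_Rop[OF assms(1)] assms(2))

lemma tpow_vec1_tmul: "tpow M (tmul 1 (vec1 v) t) = tmul 1 (vec1 (mv M v)) (tpow M t)"
proof
  fix xs
  have "lcon a (tmul 1 (vec1 v) t) = scl (v a) t" for a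
    by (simp add: lcon_def fun_eq_iff)
  then show "tpow M (tmul 1 (vec1 v) t) xs = tmul 1 (vec1 (mv M v)) (tpow M t) xs"
    by (cases xs) (simp_all add: tpow_apply pw_at_scl mv_def sum_distrib_right mult.assoc)
qed

lemma tpow_tmul_vec1:
  assumes "t \<in> Tens n"
  shows "tpow M (tmul n t (vec1 w)) = tmul n (tpow M t) (vec1 (mv M w))"
proof
  fix xs
  have T: "tmul n t (vec1 w) \<in> Tens (n + 1)" "tmul n (tpow M t) (vec1 (mv M w)) \<in> Tens (n + 1)"
    using Tens_tmul[OF assms Tens_vec1] Tens_tmul[OF Tens_tpow[OF assms] Tens_vec1] by blast+
  show "tpow M (tmul n t (vec1 w)) xs = tmul n (tpow M t) (vec1 (mv M w)) xs"
  proof (cases "length xs = n + 1")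
    case True
    then obtain ys x where xs: "xs = ys @ [x]" "length ys = n" by (cases xs rule: rev_cases) auto
    then show ?thesis
      using assms
      by (simp add: tpow_apply pw_at_snoc rcon_tmul_vec1 pw_at_scl tmul_vec1_snoc mv_def sum_distrib_left mult_ac)
  next
    case False
    then show ?thesis using Tens_tpow[OF T(1), of M] T(2) by (simp add: Tens_iff)
  qed
qed

text \<open>By \<open>cyc\<close>, applying \<open>M\<close> in the first slot moves the letter
  \<open>x\<close> read there to the end of the word. Doing so for all letters is a full
  rotation.\<close>

lemma tpow_cyclic:
  assumes cyc: "\<And>i ys. t (ys @ [i]) = (\<Sum>j\<in>UNIV. M i j * t (j # ys))"
  shows "tpow M t = t"
proof
  fix xs
  \<comment> \<open>The generalisation over \<open>ys\<close> records the letters already rotated to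
    the end.\<close>
  have "pw_at M xs (\<lambda>zs. t (zs @ ys)) = t (ys @ xs)" for ys
  proof (induction xs arbitrary: ys)
    case (Cons x xs)
    have "pw_at M (x # xs) (\<lambda>zs. t (zs @ ys)) = pw_at M xs (\<Sum>a\<in>UNIV. scl (M x a) (lcon a (\<lambda>zs. t (zs @ ys))))"
      by (simp add: pw_at_sum pw_at_scl)
    also have "(\<Sum>a\<in>UNIV. scl (M x a) (lcon a (\<lambda>zs. t (zs @ ys)))) = (\<lambda>zs. t (zs @ (ys @ [x])))"
      using cyc[of "_ @ ys" x] by (simp add: fun_eq_iff sum_fun_apply lcon_def)
    finally show ?case using Cons.IH[of "ys @ [x]"] by simp
  qed simp
  from this[of "[]"] show "tpow M t xs = t xs" by (simp add: tpow_apply)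
qed

section \<open>Two vectors moved past the top form\<close>

lemma Tens_tmul_vec1_vec1 [simp]: "tmul 1 (vec1 v) (vec1 w) \<in> Tens 2"
  using Tens_tmul[OF Tens_vec1 Tens_vec1, of v w] by (simp only: one_add_one)

lemma Tens_2_expand:
  fixes f :: "('n::finite, 'k::field) tensor"
  assumes "f \<in> Tens 2"
  shows "f = (\<Sum>a\<in>UNIV. \<Sum>b\<in>UNIV. scl (f [a, b]) (tmul 1 (vec1 (unit_vec a)) (vec1 (unit_vec b))))"
proof (rule Tens_2_eqI)
  fix x y
  have "(\<Sum>b\<in>UNIV. f [a, b] * (unit_vec a x * unit_vec b y)) = (if x = a then f [a, y] else 0)" for a
    by (cases "x = a") (simp_all add: unit_vec_def if_distrib[of "\<lambda>c. _ * c"] cong: if_cong)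
  then show "f [x, y] = (\<Sum>a\<in>UNIV. \<Sum>b\<in>UNIV. scl (f [a, b]) (tmul 1 (vec1 (unit_vec a)) (vec1 (unit_vec b)))) [x, y]"
    by (simp add: sum_fun_apply)
qed (use assms in \<open>auto intro!: Tens_sum Tens_scl simp del: One_nat_def\<close>)

lemma tsq_add: "tsq M (f + g) = tsq M f + tsq M g"
  and tsq_scl: "tsq M (scl c f) = scl c (tsq M f)"
  by (auto simp: tsq_def fun_eq_iff algebra_simps sum.distrib sum_distrib_left)

lemma tsq_sum: "tsq M (sum f A) = (\<Sum>i\<in>A. tsq M (f i))"
  using sum_comp_morphism[of "tsq M" f A] tsq_scl[of M 0 0] by (simp add: tsq_add o_def)

lemma tsq_tmul: "tsq M (tmul 1 (vec1 v) (vec1 w)) = tmul 1 (vec1 (mv M v)) (vec1 (mv M w))"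
proof (rule Tens_2_eqI)
  fix x y
  have "tsq M (tmul 1 (vec1 v) (vec1 w)) [x, y] = (\<Sum>a\<in>UNIV. \<Sum>b\<in>UNIV. (M x a * v a) * (M y b * w b))"
    by (simp add: tsq_apply mult_ac)
  then show "tsq M (tmul 1 (vec1 v) (vec1 w)) [x, y] = tmul 1 (vec1 (mv M v)) (vec1 (mv M w)) [x, y]"
    by (simp add: mv_def sum_product)
qed (simp_all del: One_nat_def)

lemma tmul_left_cancel:
  assumes "t \<in> Tens n" "t \<noteq> 0" "tmul n t f = tmul n t g"
  shows "f = g"
proof
  fix xs
  obtain ys where "t ys \<noteq> 0" using assms(2) by (auto simp: fun_eq_iff)
  moreover have "length ys = n" using assms(1) calculation by (auto simp: Tens_iff)
  ultimately show "f xs = g xs" using fun_cong[OF assms(3), of "ys @ xs"] by (simp add: tmul_append)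
qed

lemma vec1_eq_iff: "vec1 v = vec1 w \<longleftrightarrow> v = w"
  by (metis vec1_single ext)

lemma desc_Suc_map: "desc (Suc n) = map Suc (desc n) @ [1]"
proof (induction n)
  case (Suc n)
  have "desc (Suc (Suc n)) = Suc (Suc n) # map Suc (desc n) @ [1]"
    by (simp only: desc.simps(2)[of "Suc n"] Suc)
  then show ?case by (simp only: desc.simps(2)[of n] list.map append_Cons)
qed simp

text \<open>The operator \<open>?W\<close> carries \<open>f t\<close> to
  \<open>t (M \<otimes> M) f\<close> for every \<open>f\<close> of degree 2. It intertwines
  \<open>R\<close> on the two leftmost slots with \<open>R\<close> on the two rightmost ones, and
  the factor \<open>t\<close> can be cancelled.\<close>

lemma (in hecke) commutes_R_if_moves:
  assumes t: "t \<in> Tens n" "t \<noteq> 0" and moves: "\<And>v. moves R n t v (mv M v)"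
  shows "commutes_R R M"
proof -
  let ?p = "Suc (Suc n)"
  let ?W = "\<lambda>f. rword ?p R (desc n) (rword ?p R (map Suc (desc n)) f)"
  have W: "?W (tmul 2 f t) = tmul n t (tsq M f)" if f: "f \<in> Tens 2" for f
  proof -
    have "?W (tmul 2 (tmul 1 (vec1 v) (vec1 w)) t) = tmul n t (tsq M (tmul 1 (vec1 v) (vec1 w)))" for v w
    proof -
      have wt: "tmul 1 (vec1 w) t \<in> Tens (Suc n)" and vt: "tmul 1 (vec1 v) t \<in> Tens (Suc n)"
        using Tens_tmul[OF Tens_vec1 t(1)] by simp_all
      have "rword (1 + Suc n) R (map Suc (desc n)) (tmul 1 (vec1 v) (tmul 1 (vec1 w) t))
          = tmul 1 (vec1 v) (rword (Suc n) R (map (\<lambda>i. i - 1) (map Suc (desc n))) (tmul 1 (vec1 w) t))"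
        by (intro rword_tmul_right[OF Tens_vec1 wt]) auto
      also have "map (\<lambda>i. i - 1) (map Suc (desc n)) = desc n"
        by (simp only: map_map o_def diff_Suc_1 list.map_ident)
      also have "rword (Suc n) R (desc n) (tmul 1 (vec1 w) t) = tmul n t (vec1 (mv M w))"
        using moves by (simp only: moves_def)
      also have "tmul 1 (vec1 v) (tmul n t (vec1 (mv M w))) = tmul (Suc n) (tmul 1 (vec1 v) t) (vec1 (mv M w))"
        using tmul_assoc[of 1 n "vec1 v" t "vec1 (mv M w)"] by simp
      finally have *: "rword ?p R (map Suc (desc n)) (tmul 2 (tmul 1 (vec1 v) (vec1 w)) t)
          = tmul (Suc n) (tmul 1 (vec1 v) t) (vec1 (mv M w))"
        using tmul_assoc[of 1 1 "vec1 v" "vec1 w" t] by (simp only: plus_1_eq_Suc Suc_1)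
      have "rword (Suc n + 1) R (desc n) (tmul (Suc n) (tmul 1 (vec1 v) t) (vec1 (mv M w)))
          = tmul (Suc n) (rword (Suc n) R (desc n) (tmul 1 (vec1 v) t)) (vec1 (mv M w))"
        by (intro rword_tmul_left[OF vt Tens_vec1]) auto
      also have "\<dots> = tmul n t (tmul 1 (vec1 (mv M v)) (vec1 (mv M w)))"
        using moves[of v] tmul_assoc[of n 1 t "vec1 (mv M v)" "vec1 (mv M w)"] by (simp add: moves_def)
      finally show ?thesis by (simp only: * tsq_tmul Suc_eq_plus1[symmetric])
    qed
    then have "?W (tmul 2 (\<Sum>a\<in>UNIV. \<Sum>b\<in>UNIV. scl (f [a, b]) (tmul 1 (vec1 (unit_vec a)) (vec1 (unit_vec b)))) t)
        = tmul n t (tsq M (\<Sum>a\<in>UNIV. \<Sum>b\<in>UNIV. scl (f [a, b]) (tmul 1 (vec1 (unit_vec a)) (vec1 (unit_vec b)))))"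
      by (simp only: tmul_sum_left tmul_sum_right tmul_scl_left tmul_scl_right rword_sum rword_scl tsq_sum tsq_scl)
    then show ?thesis by (simp only: Tens_2_expand[OF f, symmetric])
  qed
  \<comment> \<open>Prefixing \<open>T_(n+1)\<close> completes \<open>A_n\<close> to
    \<open>A_(n+1)\<close>. Pulling the shifted \<open>A_n\<close> through it yields
    \<open>A_n A_(n+1)\<close>, and the last letter of \<open>A_(n+1)\<close> is the wanted
    \<open>T_1\<close>.\<close>
  have comm: "Rop ?p (Suc n) R (?W f) = ?W (Rop ?p 1 R f)" for f
  proof -
    have "Rop ?p (Suc n) R (?W f) = rword ?p R (desc (Suc n)) (rword ?p R (map Suc (desc n)) f)"
      by simp
    also have "\<dots> = rword ?p R (desc n) (rword ?p R (desc (Suc n)) f)"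
      by (intro rword_descending[symmetric]) auto
    also have "\<dots> = ?W (Rop ?p 1 R f)"
      by (simp only: desc_Suc_map rword_append rword_Cons rword_Nil)
    finally show ?thesis .
  qed
  show ?thesis
    unfolding commutes_R_def
  proof
    fix f :: "('n, 'k) tensor" assume f: "f \<in> Tens 2"
    have "tmul n t (tsq M (Rop 2 1 R f)) = ?W (tmul 2 (Rop 2 1 R f) t)"
      by (rule W[symmetric]) simp
    also have "tmul 2 (Rop 2 1 R f) t = Rop ?p 1 R (tmul 2 f t)"
      using Rop_tmul_left[OF f t(1), of 1 R] by simp
    also have "?W (Rop ?p 1 R (tmul 2 f t)) = Rop ?p (Suc n) R (tmul n t (tsq M f))"
      by (simp only: comm[symmetric] W[OF f])
    also have "\<dots> = tmul n t (Rop 2 1 R (tsq M f))"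
      using Rop_tmul_right[OF t(1) Tens_tsq[of M f], of "Suc n" R] by (simp add: numeral_2_eq_2)
    finally show "tsq M (Rop 2 1 R f) = Rop 2 1 R (tsq M f)"
      by (rule tmul_left_cancel[OF t])
  qed
qed

section \<open>The ideal annihilates $\Upsilon$\<close>

text \<open>The canonical pairing in degree \<open>n\<close>. It turns congruences modulo the ideal,
  the form in which the Nakayama identity of the quadratic dual is given, into equations between
  coefficients of \<open>t\<close>.\<close>

primrec pairing :: "nat \<Rightarrow> ('n::finite, 'k::field) tensor \<Rightarrow> ('n, 'k) tensor \<Rightarrow> 'k" where
  "pairing 0 F f = F [] * f []"
| "pairing (Suc n) F f = (\<Sum>x\<in>UNIV. pairing n (lcon x F) (lcon x f))"

lemma lcon_diff: "lcon x (f - g) = lcon x f - lcon x g"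
  by (simp add: lcon_def fun_eq_iff)

lemma pairing_add_left: "pairing n (F + G) f = pairing n F f + pairing n G f"
  by (induction n arbitrary: F G f) (simp_all only: pairing.simps lcon_add plus_fun_apply distrib_right sum.distrib)

lemma pairing_diff_left: "pairing n (F - G) f = pairing n F f - pairing n G f"
  by (induction n arbitrary: F G f) (simp_all only: pairing.simps lcon_diff minus_apply left_diff_distrib sum_subtractf)

lemma pairing_scl_left: "pairing n (scl c F) f = c * pairing n F f"
  by (induction n arbitrary: F f) (simp_all add: lcon_scl sum_distrib_left mult.assoc)

lemma pairing_zero_left [simp]: "pairing n 0 f = 0"
  using pairing_scl_left[of n 0 0 f] by simp

lemma pairing_sum_left: "pairing n (sum F A) f = (\<Sum>i\<in>A. pairing n (F i) f)"
  using sum_comp_morphism[of "\<lambda>F. pairing n F f" F A] by (simp add: pairing_add_left o_def)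

lemma pairing_add_right: "pairing n F (f + g) = pairing n F f + pairing n F g"
  by (induction n arbitrary: F f g) (simp_all only: pairing.simps lcon_add plus_fun_apply distrib_left sum.distrib)

lemma pairing_scl_right: "pairing n F (scl c f) = c * pairing n F f"
  by (induction n arbitrary: F f) (simp_all add: lcon_scl sum_distrib_left mult.left_commute)

lemma pairing_sum_right: "pairing n F (sum f A) = (\<Sum>i\<in>A. pairing n F (f i))"
  using sum_comp_morphism[of "pairing n F" f A] pairing_scl_right[of n F 0 0]
  by (simp add: pairing_add_right o_def)

lemma pairing_eq_0:
  "(\<And>xs. length xs = n \<Longrightarrow> f xs = 0) \<Longrightarrow> pairing n F f = 0"
proof (induction n arbitrary: F f)
  case (Suc n)
  then show ?case by (auto simp: lcon_def intro!: sum.neutral)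
qed simp

lemma pairing_ebasis:
  fixes f :: "('n::finite, 'k::field) tensor"
  shows "pairing (length zs) (ebasis zs) f = f zs"
proof (induction zs arbitrary: f)
  case (Cons z zs)
  have "lcon x (ebasis (z # zs)) = (if x = z then ebasis zs else (0 :: ('n, 'k) tensor))" for x
    by (auto simp: lcon_def ebasis_def fun_eq_iff)
  then have "pairing (length zs) (lcon x (ebasis (z # zs))) (lcon x f) = (if x = z then f (z # zs) else 0)" for x
    using Cons.IH[of "lcon z f"] by (simp add: lcon_def)
  then show ?case by simp
qed (simp add: ebasis_def)

lemma pairing_tmul_prefix:
  assumes "\<And>pre. length pre = i \<Longrightarrow> pairing m G (\<lambda>ys. f (pre @ ys)) = 0"
  shows "pairing (i + m) (tmul i a G) f = 0"
  using assms
proof (induction i arbitrary: a f)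
  case 0
  have "tmul 0 a G = scl (a []) G" by (simp add: tmul_def fun_eq_iff)
  moreover have "pairing m G f = 0" using 0[of "[]"] by simp
  ultimately show ?case by (simp only: add_0 pairing_scl_left mult_zero_right)
next
  case (Suc i)
  have "pairing (i + m) (tmul i (lcon x a) G) (lcon x f) = 0" for x
  proof (rule Suc.IH)
    fix pre :: "'a list" assume "length pre = i"
    then show "pairing m G (\<lambda>ys. lcon x f (pre @ ys)) = 0"
      using Suc.prems[of "x # pre"] by (simp add: lcon_def)
  qed
  moreover have "lcon x (tmul (Suc i) a G) = tmul i (lcon x a) G" for x
    by (simp add: lcon_def tmul_def fun_eq_iff)
  ultimately show ?case by simp
qed

lemma pairing_tmul_2:
  "pairing (Suc (Suc j)) (tmul 2 r b) f
    = pairing j b (\<Sum>x\<in>UNIV. \<Sum>y\<in>UNIV. scl (r [x, y]) (lcon y (lcon x f)))"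
proof -
  have "lcon y (lcon x (tmul 2 r b)) = scl (r [x, y]) b" for x y
    by (simp add: lcon_def tmul_def fun_eq_iff numeral_2_eq_2)
  then show ?thesis
    by (simp add: pairing_scl_left pairing_scl_right pairing_sum_right)
qed

context hecke
begin

text \<open>For any choice of the outer letters, the two slots of \<open>f\<close> that face
  \<open>r\<close> form an element of degree 2 of \<Upsilon>, which \<open>r\<close>
  annihilates.\<close>

lemma pairing_generator:
  assumes f: "f \<in> Ups R q (i + 2 + j)" and r: "r \<in> Perp R q"
  shows "pairing (i + 2 + j) (tmul (i + 2) (tmul i a r) b) f = 0"
proof -
  have "pairing (i + Suc (Suc j)) (tmul i a (tmul 2 r b)) f = 0"
  proof (rule pairing_tmul_prefix)
    fix pre :: "'n list" assume pre: "length pre = i"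
    have "(\<Sum>x\<in>UNIV. \<Sum>y\<in>UNIV. r [x, y] * f (pre @ x # y # zs)) = 0" if "length zs = j" for zs
    proof -
      have "slice 2 pre zs f \<in> Ups R q 2"
        using f pre that by (intro slice_Ups) auto
      then have "(\<Sum>x\<in>UNIV. \<Sum>y\<in>UNIV. r [x, y] * slice 2 pre zs f [x, y]) = 0"
        using r unfolding Perp_def by blast
      then show ?thesis by (simp add: slice_def)
    qed
    then show "pairing (Suc (Suc j)) (tmul 2 r b) (\<lambda>ys. f (pre @ ys)) = 0"
      unfolding pairing_tmul_2 by (intro pairing_eq_0) (simp add: sum_fun_apply lcon_def)
  qed
  moreover have "i + 2 + j = i + Suc (Suc j)" by simp
  ultimately show ?thesis by (simp only: tmul_assoc)
qed

lemma pairing_Idl: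
  assumes f: "f \<in> Ups R q p" and F: "F \<in> Idl R q p"
  shows "pairing p F f = 0"
proof -
  interpret vector_space "scl :: 'k \<Rightarrow> ('n list \<Rightarrow> 'k) \<Rightarrow> _" by (rule vector_space_scl)
  have "subspace {F. pairing p F f = 0}"
    by (rule subspaceI) (simp_all add: pairing_add_left pairing_scl_left)
  moreover have "{tmul (i + 2) (tmul i a r) b | i j a r b. i + 2 + j = p \<and> a \<in> Tens i \<and> r \<in> Perp R q \<and> b \<in> Tens j}
      \<subseteq> {F. pairing p F f = 0}"
    using f pairing_generator by blast
  ultimately have "Idl R q p \<subseteq> {F. pairing p F f = 0}"
    unfolding Idl_def by (intro span_minimal)
  then show ?thesis using F by blast
qed

text \<open>The Nakayama identity is used for a dual basis vector \<open>a\<close> and a dual basis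
  word \<open>b\<close> of length \<open>m\<close>. Paired with \<open>t\<close>, the product
  \<open>ba\<close> gives the left side and \<mu>(a)b the right side.\<close>

lemma nakayama_Sdual_cyclic:
  assumes t: "t \<in> Ups R q (Suc m)" and mu: "nakayama_Sdual R q (Suc m) \<mu>"
    and psi: "\<And>F. \<mu> 1 (vec1 F) = vec1 (\<lambda>j. \<Sum>i\<in>UNIV. F i * \<psi> i j)"
  shows "t (ys @ [i]) = (\<Sum>j\<in>UNIV. \<psi> i j * t (j # ys))"
proof (cases "length ys = m")
  case True
  have b: "ebasis ys \<in> Tens m" using ebasis_Tens[of ys] True by simp
  \<comment> \<open>The dual operator acts by the transposed matrix, so the basis covector with
    index \<open>i\<close> goes to row \<open>i\<close> of \<psi>.\<close>
  have mu_i: "\<mu> 1 (vec1 (unit_vec i)) = vec1 (\<psi> i)"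
    unfolding psi by (simp add: unit_vec_def if_distrib[of "\<lambda>c. c * _"] cong: if_cong)
  have "\<forall>a\<in>Tens 1. \<forall>b\<in>Tens m. tmul m b a - tmul 1 (\<mu> 1 a) b \<in> Idl R q (Suc m)"
    using mu unfolding nakayama_Sdual_def by (metis Suc_le_mono diff_Suc_1 le0 One_nat_def)
  then have "tmul m (ebasis ys) (vec1 (unit_vec i)) - tmul 1 (vec1 (\<psi> i)) (ebasis ys) \<in> Idl R q (Suc m)"
    using b Tens_vec1 mu_i by metis
  from pairing_Idl[OF t this]
  have "pairing (Suc m) (tmul m (ebasis ys) (vec1 (unit_vec i))) t = pairing (Suc m) (tmul 1 (vec1 (\<psi> i)) (ebasis ys)) t"
    by (simp only: pairing_diff_left right_minus_eq)
  moreover have "tmul m (ebasis ys) (vec1 (unit_vec i)) = (ebasis (ys @ [i]) :: ('n, 'k) tensor)"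
  proof
    fix xs
    show "tmul m (ebasis ys) (vec1 (unit_vec i)) xs = (ebasis (ys @ [i]) xs :: 'k)"
    proof (cases xs rule: rev_cases)
      case Nil
      then show ?thesis using True by (auto simp: tmul_def ebasis_def vec1_def)
    next
      case (snoc zs x)
      show ?thesis
      proof (cases "length zs = m")
        case True
        then show ?thesis by (simp add: snoc tmul_vec1_snoc ebasis_def unit_vec_def)
      next
        case False
        have "tmul m (ebasis ys) (vec1 (unit_vec i)) \<in> (Tens (m + 1) :: ('n, 'k) tensor set)"
          by (rule Tens_tmul[OF b Tens_vec1])
        then show ?thesis using False True by (auto simp: Tens_iff snoc ebasis_def)
      qed
    qed
  qed
  moreover have "tmul 1 (vec1 (\<psi> i)) (ebasis ys) = (\<Sum>j\<in>UNIV. scl (\<psi> i j) (ebasis (j # ys)))"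
  proof
    fix xs
    show "tmul 1 (vec1 (\<psi> i)) (ebasis ys) xs = (\<Sum>j\<in>UNIV. scl (\<psi> i j) (ebasis (j # ys))) xs"
    proof (cases xs)
      case (Cons x zs)
      have "\<psi> i j * ebasis (j # ys) (x # zs) = (if j = x then \<psi> i x * ebasis ys zs else 0)" for j
        by (simp add: ebasis_def)
      then show ?thesis by (simp add: Cons sum_fun_apply)
    qed (simp add: sum_fun_apply ebasis_def)
  qed
  ultimately show ?thesis
    using pairing_ebasis[of "ys @ [i]" t] pairing_ebasis[of "_ # ys" t] True
    by (simp add: pairing_sum_left pairing_scl_left del: pairing.simps)
next
  case False
  then show ?thesis using Ups_Tens[OF t] by (simp add: Tens_iff)
qed

end

section \<open>The relations between the Nakayama automorphisms and $\theta$\<close>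

theorem theorem3p8:
  fixes R :: "'n::finite \<Rightarrow> 'n \<Rightarrow> 'n \<Rightarrow> 'n \<Rightarrow> 'k::field"
    and q :: 'k and n :: nat and t :: "('n, 'k) tensor"
    and \<nu> \<mu> :: "nat \<Rightarrow> ('n, 'k) tensor \<Rightarrow> ('n, 'k) tensor"
    and \<phi> \<psi> \<theta> :: "'n \<Rightarrow> 'n \<Rightarrow> 'k"
  assumes hecke: "hecke_symmetry R q"
    and npos: "n > 0"
    and dim1: "vector_space.dim scl (Ups R q n) = 1"
    and top: "Ups R q (n + 1) = {0}"
    and t: "t \<in> Ups R q n" "t \<noteq> 0"
    and nu: "nakayama_Ups R q n \<nu>"
    and phi: "\<forall>v. \<nu> 1 (vec1 v) = vec1 (mv \<phi> v)"
    and mu: "nakayama_Sdual R q n \<mu>"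
    and psi: "\<forall>F. \<mu> 1 (vec1 F) = vec1 (\<lambda>j. \<Sum>i\<in>UNIV. F i * \<psi> i j)"
    and theta: "\<forall>v. foldr (\<lambda>i g. Rop (n + 1) i R g) (rev [1..<n + 1]) (tmul 1 (vec1 v) t)
                     = tmul n t (vec1 (mv \<theta> v))"
  shows "mm \<phi> \<psi> = mm \<psi> \<phi> \<and> mm \<phi> \<theta> = mm \<theta> \<phi> \<and> mm \<psi> \<theta> = mm \<theta> \<psi>
    \<and> \<psi> = (\<lambda>i j. inverse (q ^ (n + 1)) * mm \<phi> (mm \<theta> \<theta>) i j)
    \<and> (\<forall>\<chi>\<in>{\<phi>, \<psi>, \<theta>}. \<forall>f\<in>Tens 2. tsq \<chi> (Rop 2 1 R f) = Rop 2 1 R (tsq \<chi> f))"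
proof -
  interpret hecke R q by standard (rule hecke)
  obtain m where n: "n = Suc m" using npos by (cases n) auto
  define Q where "Q = q ^ Suc n"
  have Q [simp]: "Q \<noteq> 0" by (simp add: Q_def)
  have T: "t \<in> Tens n" by (rule Ups_Tens[OF t(1)])
  have tm: "t \<in> Ups R q (Suc m)" using t(1) n by simp
  have L0: "lstar R q n (vec1 v) t = 0" for v
    using lstar_Ups[OF Tens_vec1 t(1), of v] top by simp
  have R0: "rstar R q n t (vec1 v) = 0" for v
    using rstar_Ups[OF t(1) Tens_vec1, of v] top by simp
  have mov: "moves R n t v (mv \<theta> v)" for v
    using theta[rule_format, of v] by (simp only: moves_def rword_def desc_eq One_nat_def add_Suc_right add_0_right)
  have nak: "rstar R q m b (vec1 v) = lstar R q m (vec1 (mv \<phi> v)) b" if b: "b \<in> Ups R q m" for b v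
  proof -
    have "vec1 v \<in> Ups R q 1" by (simp add: Ups_1)
    moreover have "n - 1 = m" "1 \<le> n" using n by simp_all
    ultimately have "star R q m 1 b (vec1 v) = star R q 1 m (\<nu> 1 (vec1 v)) b"
      using nu b unfolding nakayama_Ups_def by metis
    then show ?thesis by (simp only: star_1 star_last phi[rule_format])
  qed
  have cyc: "t (ys @ [i]) = (\<Sum>j\<in>UNIV. \<psi> i j * t (j # ys))" for ys i
    using nakayama_Sdual_cyclic[OF tm mu[unfolded n], of \<psi> ys i] psi by blast
  have rl: "rcon i t = (\<Sum>j\<in>UNIV. scl (\<psi> i j) (lcon j t))" for i
    by (simp add: rcon_def lcon_def cyc fun_eq_iff sum_fun_apply)

  \<comment> \<open>The product of \<open>rcon i t\<close> with \<theta> u is evaluated in two ways.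
    The vector has the form \<theta> u because \<open>rstar_lcon\<close> computes right products
    with results of moves.\<close>
  have Qpsi: "mv \<theta> (mv \<phi> (mv \<theta> u)) = (\<lambda>i. Q * mv \<psi> u i)" for u
  proof
    fix i
    have "rstar R q m (rcon i t) (vec1 (mv \<theta> u)) = lstar R q m (vec1 (mv \<phi> (mv \<theta> u))) (rcon i t)"
      by (rule nak[OF rcon_Ups[OF tm]])
    moreover have "scl q (rstar R q m (rcon i t) (vec1 (mv \<theta> u))) = scl ((-1) ^ m * (Q * mv \<psi> u i)) t"
    proof -
      have "scl q (rstar R q m (lcon j t) (vec1 (mv \<theta> u))) = scl ((-1) ^ m * (Q * u j)) t" for j
        unfolding Q_def n using rstar_lcon[OF tm] L0 R0 mov unfolding n by blast
      then have "scl q (rstar R q m (rcon i t) (vec1 (mv \<theta> u))) = (\<Sum>j\<in>UNIV. scl (\<psi> i j * ((-1) ^ m * (Q * u j))) t)"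
        by (simp only: rl rstar_sum_left rstar_scl_left scl_sum scl_scl mult.commute[of q])
          (simp only: scl_scl[symmetric])
      also have "\<dots> = scl ((-1) ^ m * (Q * mv \<psi> u i)) t"
        by (simp add: fun_eq_iff sum_fun_apply mv_def sum_distrib_left sum_distrib_right mult_ac)
      finally show ?thesis .
    qed
    moreover have "scl q (lstar R q m (vec1 (mv \<phi> (mv \<theta> u))) (rcon i t))
        = scl ((-1) ^ m * mv \<theta> (mv \<phi> (mv \<theta> u)) i) t"
      using lstar_rcon[of t m] T L0 mov unfolding n by blast
    ultimately have "scl ((-1) ^ m * mv \<theta> (mv \<phi> (mv \<theta> u)) i) t = scl ((-1) ^ m * (Q * mv \<psi> u i)) t"
      by (simp only:)
    then show "mv \<theta> (mv \<phi> (mv \<theta> u)) i = Q * mv \<psi> u i"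
      using scl_cancel[OF _ t(2)] by fastforce
  qed

  have psi_R: "commutes_R R \<psi>"
  proof (cases m)
    case 0 \<comment> \<open>Here $\Upsilon^{(2)} = 0$ forces $R = q$.\<close>
    have "Rop 2 1 R f = scl q f" if "f \<in> Tens 2" for f
    proof -
      have "Rop 2 1 R f - scl q f \<in> Ups R q 2"
        unfolding Ups_def using that Tens_diff[OF Tens_Rop[of 2 1 R f] Tens_scl[OF that, of q]]
        by (auto simp: numeral_2_eq_2)
      then show ?thesis using top n 0 by (simp add: numeral_2_eq_2)
    qed
    then show ?thesis by (simp add: commutes_R_def tsq_scl)
  next
    case (Suc r)
    have tr: "t \<in> Ups R q (Suc (Suc r))" using tm Suc by simp
    \<comment> \<open>The entry at (i, j) of (\<psi> \<otimes> \<psi>)(q - R)(u \<otimes> u') = (q -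
      R)(\<psi> u \<otimes> \<psi> u'). It comes from multiplying \<open>t\<close>, contracted in
      its last two slots, by \<theta> u and \<theta> u'.\<close>
    have key: "(\<Sum>j'\<in>UNIV. \<Sum>i'\<in>UNIV. \<psi> j j' * \<psi> i i' * qR R q u u' i' j') = qR R q (mv \<psi> u) (mv \<psi> u') i j" for i j u u'
    proof -
      let ?x = "rcon i (rcon j t)" and ?v = "mv \<theta> u" and ?v' = "mv \<theta> u'"
      have x: "?x \<in> Ups R q r" by (rule rcon_Ups[OF rcon_Ups[OF tr]])
      have "rstar R q m (rstar R q r ?x (vec1 ?v)) (vec1 ?v') = lstar R q m (vec1 (mv \<phi> ?v')) (rstar R q r ?x (vec1 ?v))"
        by (rule nak) (use rstar_Ups[OF x Tens_vec1] Suc in simp)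
      also have "\<dots> = rstar R q m (lstar R q r (vec1 (mv \<phi> ?v')) ?x) (vec1 ?v)"
        using lstar_rstar_assoc[OF Tens_vec1 Ups_Tens[OF x] Tens_vec1] Suc by simp
      also have "\<dots> = lstar R q m (vec1 (mv \<phi> ?v)) (lstar R q r (vec1 (mv \<phi> ?v')) ?x)"
        by (rule nak) (use lstar_Ups[OF Tens_vec1 x] Suc in simp)
      finally have "scl (q ^ 3) (rstar R q (Suc r) (rstar R q r ?x (vec1 ?v)) (vec1 ?v'))
          = scl (q ^ 3) (lstar R q (Suc r) (vec1 (mv \<phi> ?v)) (lstar R q r (vec1 (mv \<phi> ?v')) ?x))"
        by (simp only: Suc)
      also have "\<dots> = scl (qR R q (mv \<theta> (mv \<phi> ?v)) (mv \<theta> (mv \<phi> ?v')) i j) t"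
        using T L0 mov unfolding n Suc by (intro lstar_lstar_rcon) auto
      \<comment> \<open>\<open>Qpsi\<close> for both vectors yields the same
        \<open>Q\<^sup>2\<close> that the mirrored double product contributes on the other
        side.\<close>
      also have "qR R q (mv \<theta> (mv \<phi> ?v)) (mv \<theta> (mv \<phi> ?v')) i j = Q\<^sup>2 * qR R q (mv \<psi> u) (mv \<psi> u') i j"
        unfolding Qpsi qR_def by (simp add: algebra_simps sum_distrib_left power2_eq_square)
      also have "?x = (\<Sum>j'\<in>UNIV. \<Sum>i'\<in>UNIV. scl (\<psi> j j' * \<psi> i i') (lcon j' (lcon i' t)))"
      proof -
        have "rcon i (lcon j' t) = lcon j' (rcon i t)" for j'
          by (simp add: rcon_def lcon_def)
        then show ?thesis
          by (simp only: rl[of j] rcon_sum rcon_scl) (simp only: rl lcon_sum lcon_scl scl_sum scl_scl)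
      qed
      also have "scl (q ^ 3) (rstar R q (Suc r) (rstar R q r
            (\<Sum>j'\<in>UNIV. \<Sum>i'\<in>UNIV. scl (\<psi> j j' * \<psi> i i') (lcon j' (lcon i' t))) (vec1 ?v)) (vec1 ?v'))
          = (\<Sum>j'\<in>UNIV. \<Sum>i'\<in>UNIV. scl (\<psi> j j' * \<psi> i i')
              (scl (q ^ 3) (rstar R q (Suc r) (rstar R q r (lcon j' (lcon i' t)) (vec1 ?v)) (vec1 ?v'))))"
        by (simp only: rstar_sum_left rstar_scl_left scl_sum scl_scl mult.commute)
      also have "\<dots> = (\<Sum>j'\<in>UNIV. \<Sum>i'\<in>UNIV. scl (\<psi> j j' * \<psi> i i') (scl (Q\<^sup>2 * qR R q u u' i' j') t))"
      proof -
        have "scl (q ^ 3) (rstar R q (Suc r) (rstar R q r (lcon j' (lcon i' t)) (vec1 ?v)) (vec1 ?v'))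
            = scl (Q\<^sup>2 * qR R q u u' i' j') t" for i' j'
          using L0 R0 mov unfolding n Suc Q_def by (intro rstar_rstar_lcon[OF tr]) auto
        then show ?thesis by (simp only:)
      qed
      also have "\<dots> = scl (Q\<^sup>2 * (\<Sum>j'\<in>UNIV. \<Sum>i'\<in>UNIV. \<psi> j j' * \<psi> i i' * qR R q u u' i' j')) t"
        by (simp add: fun_eq_iff sum_fun_apply sum_distrib_left sum_distrib_right mult_ac)
      finally have "Q\<^sup>2 * (\<Sum>j'\<in>UNIV. \<Sum>i'\<in>UNIV. \<psi> j j' * \<psi> i i' * qR R q u u' i' j') = Q\<^sup>2 * qR R q (mv \<psi> u) (mv \<psi> u') i j"
        by (rule scl_cancel[OF _ t(2)])
      then show ?thesis by simp
    qed
    show ?thesis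
      unfolding commutes_R_iff
    proof (intro allI)
      fix x y c d
      have unit: "(\<Sum>a\<in>UNIV. \<Sum>b\<in>UNIV. R i j a b * unit_vec c a * unit_vec d b) = R i j c d" for i j
      proof -
        have "(\<Sum>b\<in>UNIV. R i j a b * unit_vec c a * unit_vec d b) = (if a = c then R i j c d else 0)" for a
          by (simp add: unit_vec_def if_distrib[of "\<lambda>c. _ * c"] cong: if_cong)
        then show ?thesis by simp
      qed
      \<comment> \<open>The scalar part of q - R gives equal contributions to both sides of
        \<open>key\<close>; what remains is the relation for \<open>R\<close>.\<close>
      have unit': "(\<Sum>j'\<in>UNIV. \<Sum>i'\<in>UNIV. \<psi> y j' * \<psi> x i' * (q * unit_vec c i' * unit_vec d j')) = q * \<psi> x c * \<psi> y d"
      proof -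
        have "(\<Sum>i'\<in>UNIV. \<psi> y j' * \<psi> x i' * (q * unit_vec c i' * unit_vec d j')) = (if j' = d then q * \<psi> x c * \<psi> y d else 0)" for j'
          by (simp add: unit_vec_def if_distrib[of "\<lambda>c. _ * c"] if_distrib[of "\<lambda>c. c * _"] mult_ac cong: if_cong)
        then show ?thesis by simp
      qed
      have "(\<Sum>a\<in>UNIV. \<Sum>b\<in>UNIV. \<psi> x a * \<psi> y b * R a b c d) = (\<Sum>j'\<in>UNIV. \<Sum>i'\<in>UNIV. \<psi> y j' * \<psi> x i' * R i' j' c d)"
        by (subst sum.swap) (simp only: mult.commute)
      also have "\<dots> = (\<Sum>a\<in>UNIV. \<Sum>b\<in>UNIV. R x y a b * (\<psi> a c * \<psi> b d))"
        using key[of y x "unit_vec c" "unit_vec d"]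
        by (simp only: qR_def unit mv_unit_vec right_diff_distrib sum_subtractf unit') (simp add: mult.assoc)
      finally show "(\<Sum>a\<in>UNIV. \<Sum>b\<in>UNIV. \<psi> x a * \<psi> y b * R a b c d) = (\<Sum>a\<in>UNIV. \<Sum>b\<in>UNIV. R x y a b * (\<psi> a c * \<psi> b d))" .
    qed
  qed

  have psi_theta: "mv \<psi> (mv \<theta> v) = mv \<theta> (mv \<psi> v)" for v
  proof -
    have "tpow \<psi> t = t" by (rule tpow_cyclic) (rule cyc)
    moreover have "tmul 1 (vec1 v) t \<in> Tens (Suc n)" using Tens_tmul[OF Tens_vec1 T, of v] by simp
    moreover have "set (desc n) \<subseteq> {1..<Suc n}" by auto
    ultimately have "tmul n t (vec1 (mv \<psi> (mv \<theta> v))) = rword (Suc n) R (desc n) (tmul 1 (vec1 (mv \<psi> v)) t)"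
      using arg_cong[OF mov[of v, unfolded moves_def], of "tpow \<psi>"]
      by (simp only: tpow_rword[OF psi_R] tpow_vec1_tmul tpow_tmul_vec1[OF T])
    also have "\<dots> = tmul n t (vec1 (mv \<theta> (mv \<psi> v)))"
      using mov by (simp only: moves_def)
    finally show ?thesis
      using tmul_left_cancel[OF T t(2)] vec1_eq_iff by blast
  qed

  \<comment> \<open>If \<theta> v = 0 then \<open>A_n(vt)\<close> vanishes, and the Jucys-Murphy
    identity leaves \<open>Q\<close> times \<open>vt\<close> equal to zero.\<close>
  obtain N where N: "mm \<theta> N = idm" "mm N \<theta> = idm"
  proof (rule matrix_inverse_exists[of \<theta>])
    fix v assume "mv \<theta> v = 0"
    then have "rword (Suc n) R (desc n) (tmul 1 (vec1 v) t) = 0"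
      using mov[of v] by (simp add: moves_def tmul_def vec1_def fun_eq_iff split: list.splits)
    then have "scl Q (tmul 1 (vec1 v) t) = 0"
      using ascending_descending_top[OF t(1) Tens_vec1 L0, of v] by (simp add: Q_def)
    then have "scl Q (tmul 1 (vec1 v) t) (x # ys) = 0" for x ys
      by (simp only: zero_fun_apply)
    then have "v x * t ys = 0" for x ys by simp
    then show "v = 0" using t(2) by (auto simp: fun_eq_iff)
  qed
  have N_theta: "mv N (mv \<theta> v) = v" and theta_N: "mv \<theta> (mv N v) = v" for v
    using N by (simp_all add: mv_idm flip: mv_mm)
  have mv_scale: "mv M (\<lambda>i. c * v i) = (\<lambda>i. c * mv M v i)" for M :: "'n \<Rightarrow> 'n \<Rightarrow> 'k" and c v
    by (simp add: mv_def fun_eq_iff sum_distrib_left mult.left_commute)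
  have phi_theta: "mv \<phi> (mv \<theta> v) = mv \<theta> (mv \<phi> v)" for v
  proof -
    let ?u = "mv N v"
    \<comment> \<open>The operator \<theta>\<phi>\<theta> is a multiple of \<psi> and so commutes
      with \<theta>. Cancelling an outer \<theta> on the left and writing v for \<theta> u gives the
      claim.\<close>
    have "mv \<theta> (mv \<phi> (mv \<theta> (mv \<theta> ?u))) = mv \<theta> (mv \<theta> (mv \<phi> (mv \<theta> ?u)))"
      by (simp only: Qpsi psi_theta mv_scale)
    then show ?thesis by (metis N_theta theta_N)
  qed
  have psi_eq: "mv \<psi> v = (\<lambda>i. inverse Q * mv \<phi> (mv \<theta> (mv \<theta> v)) i)" for v
    using Qpsi[of v] by (simp add: phi_theta fun_eq_iff)
  have phi_psi: "mv \<phi> (mv \<psi> v) = mv \<psi> (mv \<phi> v)" for v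
    by (simp only: psi_eq mv_scale phi_theta)
  have theta_R: "commutes_R R \<theta>"
    by (rule commutes_R_if_moves[OF T t(2) mov])
  have N_R: "commutes_R R N"
    by (rule commutes_R_inverse[OF theta_R N])
  \<comment> \<open>Solving the main relation for \<phi> expresses it through \<psi> and the inverse
    of \<theta>, whose tensor squares are already known to commute with \<open>R\<close>.\<close>
  have "\<phi> = (\<lambda>i j. Q * mm \<psi> (mm N N) i j)"
  proof (rule matrix_eqI)
    fix v
    have "mv (\<lambda>i j. Q * mm \<psi> (mm N N) i j) v = (\<lambda>i. Q * mv \<psi> (mv N (mv N v)) i)"
      by (simp add: mv_mm[symmetric]) (simp add: mv_def sum_distrib_left mult.assoc)
    also have "\<dots> = mv \<phi> v"
      by (simp add: psi_eq theta_N fun_eq_iff mult.assoc[symmetric])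
    finally show "mv \<phi> v = mv (\<lambda>i j. Q * mm \<psi> (mm N N) i j) v" by simp
  qed
  then have phi_R: "commutes_R R \<phi>"
    using psi_R N_R by (metis commutes_R_mm commutes_R_scale)
  have "\<psi> = (\<lambda>i j. inverse (q ^ (n + 1)) * mm \<phi> (mm \<theta> \<theta>) i j)"
  proof (rule matrix_eqI)
    fix v
    have "mv (\<lambda>i j. inverse (q ^ (n + 1)) * mm \<phi> (mm \<theta> \<theta>) i j) v
        = (\<lambda>i. inverse Q * mv (mm \<phi> (mm \<theta> \<theta>)) v i)"
      by (simp add: Q_def mv_def sum_distrib_left mult.assoc)
    then show "mv \<psi> v = mv (\<lambda>i j. inverse (q ^ (n + 1)) * mm \<phi> (mm \<theta> \<theta>) i j) v"
      by (simp only: mv_mm psi_eq)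
  qed
  moreover have "mm \<phi> \<psi> = mm \<psi> \<phi>" "mm \<phi> \<theta> = mm \<theta> \<phi>" "mm \<psi> \<theta> = mm \<theta> \<psi>"
    by (rule matrix_eqI; simp only: mv_mm phi_psi phi_theta psi_theta)+
  ultimately show ?thesis
    using phi_R psi_R theta_R unfolding commutes_R_def by blast
qed

end
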